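(* Let $n,m\ge 1$ (the index set $[m]$ of constraints may also be infinite), let $\mathbb{S}_n=\{x\in\mathbb{R}^n:\sum_i x_i=1,\ x_i\ge 0\}$, and let $\{f_j\}_{j\in[m]}$ be twice differentiable convex functions defining the feasibility program $$f_j(x)\le 0\quad \forall j\in[m],\qquad x\in\mathbb{S}_n .$$ Assume there are constants $H>0$ and $G$ such that $\nabla^2 f_j(x)\succeq H\cdot I_n$ and $\|\nabla f_j(x)\|_2\le G$ for all $j\in[m]$ and all $x\in\mathbb{S}_n$. Then there exists an algorithm that, for any $\varepsilon>0$, returns an $\varepsilon$-approximate solution to this program. The algorithm makes at most $\tilde{O}\!\left(\frac{G^2}{H}\cdot\frac{1}{\varepsilon}\right)$ calls to the Separation Oracle, and requires a single gradient computation and additional $O(n)$ time between successive oracle calls.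
   Context: An $\varepsilon$-approximate solution (additive notion) is either a point $x\in\mathbb{S}_n$ with $f_j(x)\le\varepsilon$ for all $j\in[m]$, or a proof that the program is infeasible (e.g. a probability distribution $p$ over the constraints with $\sum_j p_j f_j(x)>0$ for all $x\in\mathbb{S}_n$). The Separation Oracle, on input $x\in\mathbb{S}_n$, returns an index $j\in[m]$ with $f_j(x)>\varepsilon$ if such an index exists, and returns FAIL otherwise. $A\succeq B$ means $A-B$ is positive semidefinite. $\tilde{O}(\cdot)$ hides polylogarithmic factors. *)

theory Defs
  imports "HOL-Probability.Probability"
begin

section \<open>Calculus on \<open>\<real>\<^sup>n\<close> for variable \<open>n\<close>\<close>

text \<open>
  A single program has to work for all \<open>n\<close>, with constants that do not depend on \<open>n\<close>, so the
  dimension cannot be a type.  Points of \<open>\<real>\<^sup>n\<close> are the elements of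
  \<open>topspace (Euclidean_space n)\<close>, i.e. functions \<open>x :: nat \<Rightarrow> real\<close> with \<open>x i = 0\<close> for \<open>i \<ge> n\<close>.
  The type \<open>nat \<Rightarrow> real\<close> is not a normed space; its topology is the product topology, which
  on this set is the usual topology of \<open>\<real>\<^sup>n\<close>.
\<close>

type_synonym point = "nat \<Rightarrow> real"

definition unit_simplex :: "nat \<Rightarrow> point set" where
  "unit_simplex n =
     {x \<in> topspace (Euclidean_space n). (\<Sum>i<n. x i) = 1 \<and> (\<forall>i<n. 0 \<le> x i)}"

text \<open>Frechet differentiability of \<open>f : \<real>\<^sup>n \<rightarrow> \<real>\<close> at \<open>x\<close>, with gradient \<open>v\<close>; only the coordinates
  of \<open>v\<close> below \<open>n\<close> matter.\<close>

definition has_gradient :: "nat \<Rightarrow> (point \<Rightarrow> real) \<Rightarrow> point \<Rightarrow> point \<Rightarrow> bool" where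
  "has_gradient n f v x \<longleftrightarrow>
     ((\<lambda>y. (f y - f x - (\<Sum>i<n. v i * (y i - x i))) / L2_set (\<lambda>i. y i - x i) {..<n}) \<longlongrightarrow> 0)
       (at x within topspace (Euclidean_space n))"

definition twice_differentiable_near ::
  "nat \<Rightarrow> point set \<Rightarrow> (point \<Rightarrow> real) \<Rightarrow> (point \<Rightarrow> point) \<Rightarrow> (point \<Rightarrow> nat \<Rightarrow> nat \<Rightarrow> real) \<Rightarrow> bool"
where
  "twice_differentiable_near n S f g h \<longleftrightarrow>
     (\<exists>U. openin (Euclidean_space n) U \<and> S \<subseteq> U \<and>
        (\<forall>x\<in>U. has_gradient n f (g x) x \<and> (\<forall>i<n. has_gradient n (\<lambda>y. g y i) (h x i) x)))"

text \<open>The library constant \<open>convex_on\<close> needs a real vector space type.\<close>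

definition convex_fun_on :: "point set \<Rightarrow> (point \<Rightarrow> real) \<Rightarrow> bool" where
  "convex_fun_on S f \<longleftrightarrow>
     (\<forall>x\<in>S. \<forall>y\<in>S. \<forall>t\<in>{0..1}. f (\<lambda>i. (1 - t) * x i + t * y i) \<le> (1 - t) * f x + t * f y)"

text \<open>Only applied to Hessians (shifted by a multiple of the identity), which are symmetric.\<close>

definition psd :: "nat \<Rightarrow> (nat \<Rightarrow> nat \<Rightarrow> real) \<Rightarrow> bool" where
  "psd n A \<longleftrightarrow> (\<forall>v :: point. 0 \<le> (\<Sum>i<n. \<Sum>j<n. v i * A i j * v j))"


section \<open>Approximate solutions and the separation oracle\<close>

definition infeasibility_certificate ::
  "nat \<Rightarrow> 'j set \<Rightarrow> ('j \<Rightarrow> point \<Rightarrow> real) \<Rightarrow> 'j pmf \<Rightarrow> bool" where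
  "infeasibility_certificate n J f p \<longleftrightarrow>
     finite (set_pmf p) \<and> set_pmf p \<subseteq> J \<and>
     (\<forall>x\<in>unit_simplex n. (\<Sum>j\<in>set_pmf p. pmf p j * f j x) > 0)"

datatype 'j answer = Point point | Infeasible "'j pmf"

primrec approximate_solution ::
  "nat \<Rightarrow> 'j set \<Rightarrow> ('j \<Rightarrow> point \<Rightarrow> real) \<Rightarrow> real \<Rightarrow> 'j answer \<Rightarrow> bool" where
  "approximate_solution n J f \<epsilon> (Point x) \<longleftrightarrow> x \<in> unit_simplex n \<and> (\<forall>j\<in>J. f j x \<le> \<epsilon>)"
| "approximate_solution n J f \<epsilon> (Infeasible p) \<longleftrightarrow> infeasibility_certificate n J f p"

text \<open>\<open>orc k x\<close> is the reply to the query \<open>x\<close> when it is query number \<open>k\<close> (from 0) of the run, so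
  repeated queries may be answered differently; \<open>None\<close> is FAIL.\<close>

definition separation_oracle ::
  "nat \<Rightarrow> 'j set \<Rightarrow> ('j \<Rightarrow> point \<Rightarrow> real) \<Rightarrow> real \<Rightarrow> (nat \<Rightarrow> point \<Rightarrow> 'j option) \<Rightarrow> bool" where
  "separation_oracle n J f \<epsilon> orc \<longleftrightarrow>
     (\<forall>k. \<forall>x\<in>unit_simplex n.
        case orc k x of Some j \<Rightarrow> j \<in> J \<and> f j x > \<epsilon> | None \<Rightarrow> \<forall>j\<in>J. f j x \<le> \<epsilon>)"


section \<open>A real RAM with oracle access\<close>

text \<open>
  Programs are while programs over arrays of naturals and arrays of reals (exact arithmetic, no
  rounding function).  Every arithmetic operation, comparison, constant, memory access and
  command costs at least one \<open>Tick\<close>.  Naturals can only be added and subtracted, so that large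
  numbers cannot be used to encode bulk computations.

  Constraints are opaque to a program: it refers to a constraint by the number of the oracle
  call that returned it.
\<close>

datatype nexp =
    NConst nat
  | NGet nat nexp \<comment> \<open>array, index\<close>
  | NAdd nexp nexp
  | NSub nexp nexp

datatype rexp =
    RNat nexp
  | RGet nat nexp
  | RAdd rexp rexp
  | RSub rexp rexp
  | RMul rexp rexp
  | RDiv rexp rexp

datatype bexp =
    NLess nexp nexp
  | RLess rexp rexp
  | Not bexp
  | And bexp bexp

datatype com =
    Skip
  | NPut nat nexp nexp \<comment> \<open>array, index, value\<close>
  | RPut nat nexp rexp
  | Seq com com
  | Cond bexp com com
  | While bexp com
  | Query nat nat
      \<comment> \<open>point to query (real array), destination of the FAIL flag (cell 0 of a nat array)\<close>
  | Grad nexp nat nat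
      \<comment> \<open>number of the oracle call, point (real array), destination of the gradient (real array)\<close>

record 'j state =
  nats :: "nat \<Rightarrow> nat \<Rightarrow> nat"
  reals :: "nat \<Rightarrow> nat \<Rightarrow> real"
  replies :: "'j option list"

primrec nval :: "'j state \<Rightarrow> nexp \<Rightarrow> nat" where
  "nval s (NConst c) = c"
| "nval s (NGet a e) = nats s a (nval s e)"
| "nval s (NAdd e1 e2) = nval s e1 + nval s e2"
| "nval s (NSub e1 e2) = nval s e1 - nval s e2"

primrec rval :: "'j state \<Rightarrow> rexp \<Rightarrow> real" where
  "rval s (RNat e) = real (nval s e)"
| "rval s (RGet a e) = reals s a (nval s e)"
| "rval s (RAdd e1 e2) = rval s e1 + rval s e2"
| "rval s (RSub e1 e2) = rval s e1 - rval s e2"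
| "rval s (RMul e1 e2) = rval s e1 * rval s e2"
| "rval s (RDiv e1 e2) = rval s e1 / rval s e2"

primrec bval :: "'j state \<Rightarrow> bexp \<Rightarrow> bool" where
  "bval s (NLess e1 e2) \<longleftrightarrow> nval s e1 < nval s e2"
| "bval s (RLess e1 e2) \<longleftrightarrow> rval s e1 < rval s e2"
| "bval s (Not b) \<longleftrightarrow> \<not> bval s b"
| "bval s (And b1 b2) \<longleftrightarrow> bval s b1 \<and> bval s b2"

primrec ncost :: "nexp \<Rightarrow> nat" where
  "ncost (NConst c) = 1"
| "ncost (NGet a e) = ncost e + 1"
| "ncost (NAdd e1 e2) = ncost e1 + ncost e2 + 1"
| "ncost (NSub e1 e2) = ncost e1 + ncost e2 + 1"

primrec rcost :: "rexp \<Rightarrow> nat" where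
  "rcost (RNat e) = ncost e + 1"
| "rcost (RGet a e) = ncost e + 1"
| "rcost (RAdd e1 e2) = rcost e1 + rcost e2 + 1"
| "rcost (RSub e1 e2) = rcost e1 + rcost e2 + 1"
| "rcost (RMul e1 e2) = rcost e1 + rcost e2 + 1"
| "rcost (RDiv e1 e2) = rcost e1 + rcost e2 + 1"

primrec bcost :: "bexp \<Rightarrow> nat" where
  "bcost (NLess e1 e2) = ncost e1 + ncost e2 + 1"
| "bcost (RLess e1 e2) = rcost e1 + rcost e2 + 1"
| "bcost (Not b) = bcost b + 1"
| "bcost (And b1 b2) = bcost b1 + bcost b2 + 1"

datatype event = Tick | Oracle_Call | Gradient_Call

definition coords :: "nat \<Rightarrow> (nat \<Rightarrow> real) \<Rightarrow> point" where
  "coords n a = (\<lambda>i. if i < n then a i else 0)"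

text \<open>Big-step semantics with the trace of events.  Queries and gradient evaluations outside the
  simplex, and gradient evaluations for a call that has not happened or was answered FAIL, have
  no rule: such a program has no run.\<close>

inductive exec ::
  "nat \<Rightarrow> (nat \<Rightarrow> point \<Rightarrow> 'j option) \<Rightarrow> ('j \<Rightarrow> point \<Rightarrow> point) \<Rightarrow>
   com \<Rightarrow> 'j state \<Rightarrow> event list \<Rightarrow> 'j state \<Rightarrow> bool"
  for n :: nat and orc :: "nat \<Rightarrow> point \<Rightarrow> 'j option" and g :: "'j \<Rightarrow> point \<Rightarrow> point"
where
  exec_Skip: "exec n orc g Skip s [Tick] s"
| exec_NPut: "exec n orc g (NPut a e v) s (replicate (ncost e + ncost v + 1) Tick)
    (s\<lparr>nats := (nats s)(a := (nats s a)(nval s e := nval s v))\<rparr>)"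
| exec_RPut: "exec n orc g (RPut a e v) s (replicate (ncost e + rcost v + 1) Tick)
    (s\<lparr>reals := (reals s)(a := (reals s a)(nval s e := rval s v))\<rparr>)"
| exec_Seq: "exec n orc g c1 s t1 s' \<Longrightarrow> exec n orc g c2 s' t2 s'' \<Longrightarrow>
    exec n orc g (Seq c1 c2) s (t1 @ t2) s''"
| exec_CondTrue: "bval s b \<Longrightarrow> exec n orc g c1 s t s' \<Longrightarrow>
    exec n orc g (Cond b c1 c2) s (replicate (bcost b + 1) Tick @ t) s'"
| exec_CondFalse: "\<not> bval s b \<Longrightarrow> exec n orc g c2 s t s' \<Longrightarrow>
    exec n orc g (Cond b c1 c2) s (replicate (bcost b + 1) Tick @ t) s'"
| exec_WhileFalse: "\<not> bval s b \<Longrightarrow>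
    exec n orc g (While b c) s (replicate (bcost b + 1) Tick) s"
| exec_WhileTrue: "bval s b \<Longrightarrow> exec n orc g c s t1 s' \<Longrightarrow> exec n orc g (While b c) s' t2 s'' \<Longrightarrow>
    exec n orc g (While b c) s (replicate (bcost b + 1) Tick @ t1 @ t2) s''"
| exec_Query: "x = coords n (reals s a) \<Longrightarrow> x \<in> unit_simplex n \<Longrightarrow>
    r = orc (length (replies s)) x \<Longrightarrow>
    exec n orc g (Query a d) s [Oracle_Call]
      (s\<lparr>replies := replies s @ [r],
         nats := (nats s)(d := (nats s d)(0 := (if r = None then 1 else 0)))\<rparr>)"
| exec_Grad: "x = coords n (reals s a) \<Longrightarrow> x \<in> unit_simplex n \<Longrightarrow>
    nval s e < length (replies s) \<Longrightarrow> replies s ! nval s e = Some j \<Longrightarrow>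
    exec n orc g (Grad e a d) s (replicate (ncost e) Tick @ [Gradient_Call])
      (s\<lparr>reals := (reals s)(d := (\<lambda>i. if i < n then g j x i else reals s d i))\<rparr>)"

inductive_cases exec_elims:
  "exec n orc g Skip s t s'"
  "exec n orc g (NPut a e v) s t s'"
  "exec n orc g (RPut a e v) s t s'"
  "exec n orc g (Seq c1 c2) s t s'"
  "exec n orc g (Cond b c1 c2) s t s'"
  "exec n orc g (While b c) s t s'"
  "exec n orc g (Query a d) s t s'"
  "exec n orc g (Grad e a d) s t s'"

lemma exec_deterministic:
  "exec n orc g c s t s' \<Longrightarrow> exec n orc g c s u s'' \<Longrightarrow> u = t \<and> s'' = s'"
proof (induction arbitrary: u s'' rule: exec.induct)
  case (exec_Skip s)
  then show ?case by (rule exec_elims) simp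
next
  case (exec_NPut a e v s)
  then show ?case by (rule exec_elims) simp
next
  case (exec_RPut a e v s)
  then show ?case by (rule exec_elims) simp
next
  case (exec_Seq c1 s t1 s1 c2 t2 s2)
  from exec_Seq.prems show ?case
    by (rule exec_elims) (auto dest!: exec_Seq.IH)
next
  case (exec_CondTrue s b c1 t s1 c2)
  from exec_CondTrue.prems show ?case
    by (rule exec_elims) (use exec_CondTrue.hyps in \<open>auto dest!: exec_CondTrue.IH\<close>)
next
  case (exec_CondFalse s b c2 t s1 c1)
  from exec_CondFalse.prems show ?case
    by (rule exec_elims) (use exec_CondFalse.hyps in \<open>auto dest!: exec_CondFalse.IH\<close>)
next
  case (exec_WhileFalse s b c)
  from exec_WhileFalse.prems show ?case
    by (rule exec_elims) (use exec_WhileFalse.hyps in simp_all)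
next
  case (exec_WhileTrue s b c t1 s1 t2 s2)
  from exec_WhileTrue.prems show ?case
    by (rule exec_elims) (use exec_WhileTrue.hyps in \<open>auto dest!: exec_WhileTrue.IH\<close>)
next
  case (exec_Query x s a r d)
  from exec_Query.prems show ?case
    by (rule exec_elims) (use exec_Query.hyps in simp)
next
  case (exec_Grad x s a e j d)
  from exec_Grad.prems show ?case
    by (rule exec_elims) (use exec_Grad.hyps in \<open>simp cong: if_cong\<close>)
qed

text \<open>Inputs: \<open>n\<close> in cell 0 of nat array 0; \<open>G\<close>, \<open>H\<close>, \<open>\<epsilon>\<close> in cells 0, 1, 2 of real array 0.\<close>

definition initial_state :: "nat \<Rightarrow> real \<Rightarrow> real \<Rightarrow> real \<Rightarrow> 'j state" where
  "initial_state n G H \<epsilon> =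
     \<lparr>nats = (\<lambda>_ _. 0)(0 := (\<lambda>_. 0)(0 := n)),
      reals = (\<lambda>_ _. 0)(0 := (\<lambda>_. 0)(0 := G, 1 := H, 2 := \<epsilon>)),
      replies = []\<rparr>"

text \<open>Outputs: cell 1 of nat array 0 is 1 if the answer is a point, and 0 if it is a distribution.
  Real array 1 holds the coordinates of the point, or the weights of the oracle calls: a
  constraint gets the total weight of the calls that returned it.\<close>

primrec outputs :: "nat \<Rightarrow> 'j state \<Rightarrow> 'j answer \<Rightarrow> bool" where
  "outputs n s (Point x) \<longleftrightarrow> nats s 0 1 = 1 \<and> x = coords n (reals s 1)"
| "outputs n s (Infeasible p) \<longleftrightarrow> nats s 0 1 = 0 \<and>
     (\<forall>j. pmf p j = (\<Sum>k | k < length (replies s) \<and> replies s ! k = Some j. reals s 1 k))"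

text \<open>The work between two successive oracle calls is at most one gradient evaluation and \<open>C * n\<close> further
  steps.  To make this a bound on the whole run, the parts before the first and after the last
  call are bounded too; after the last call, one may also spend time proportional to the number
  of calls, since a certificate has one weight per call.\<close>

definition work_bounded :: "real \<Rightarrow> nat \<Rightarrow> event list \<Rightarrow> bool" where
  "work_bounded C n t \<longleftrightarrow>
     (\<forall>t1 t2 t3. t = t1 @ [Oracle_Call] @ t2 @ [Oracle_Call] @ t3 \<and> Oracle_Call \<notin> set t2 \<longrightarrow>
        count_list t2 Gradient_Call \<le> 1 \<and> real (count_list t2 Tick) \<le> C * real n) \<and>
     (let pre = takeWhile (\<lambda>e. e \<noteq> Oracle_Call) t in
        count_list pre Gradient_Call \<le> 1 \<and> real (count_list pre Tick) \<le> C * real n) \<and>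
     (let post = takeWhile (\<lambda>e. e \<noteq> Oracle_Call) (rev t) in
        count_list post Gradient_Call \<le> 1 \<and>
        real (count_list post Tick) \<le> C * (real n + real (count_list t Oracle_Call)))"

text \<open>The bound \<open>O (X * polylog X)\<close> with explicit constants; the maximum makes it meaningful
  for small \<open>X\<close>, where at least one call is needed.\<close>

definition soft_bound :: "real \<Rightarrow> nat \<Rightarrow> real \<Rightarrow> real" where
  "soft_bound C k X = C * max 1 X * (1 + ln (max 1 X)) ^ k"

end

theory Submission
  imports Defs
begin

text \<open>
  Projected online gradient descent.  If the constraint \<open>j\<^sub>t\<close> returned at \<open>x\<^sub>t\<close> has weight \<open>t\<close> and the step
  size is \<open>2 / (H (t + 1))\<close>, strong convexity makes the distance terms telescope, and
  \<open>\<Sum>t f\<^bsub>j\<^sub>t\<^esub>(u)\<close> exceeds \<open>\<Sum>t \<epsilon> - T G\<^sup>2 / H\<close>, up to projection errors, for every \<open>u\<close> in the simplex.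
  This is positive once \<open>T\<close> is about \<open>4 G\<^sup>2 / (H \<epsilon>)\<close>, and then the normalised weights are a certificate.

  The Euclidean projection onto the simplex subtracts a threshold and truncates at 0.  The
  threshold is found by bisection, and the thresholdings at the two ends of the last interval are
  averaged so as to have sum 1.  The error does not depend on \<open>n\<close>, so that
  \<open>O(log (G\<^sup>2 / (H \<epsilon>)))\<close> bisection steps suffice; \<open>H \<le> 2 G\<close> for \<open>n \<ge> 2\<close> turns \<open>G / \<epsilon>\<close> into this quantity.
  To keep the work between two calls linear in \<open>n\<close>, the oracle is called again at the current point
  before every bisection step; the replies to these further calls get weight 0.
\<close>

section \<open>Projection onto the simplex and strong convexity\<close>

text \<open>The mass left when the threshold \<theta> is subtracted and negative entries are cut
  off. It is nonincreasing in \<theta>; the projection of \<open>z\<close> is the thresholding for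
  which it equals 1.\<close>

definition pos_sum :: "nat \<Rightarrow> point \<Rightarrow> real \<Rightarrow> real" where
  "pos_sum n z \<theta> = (\<Sum>i<n. max 0 (z i - \<theta>))"

definition dist2 :: "nat \<Rightarrow> point \<Rightarrow> point \<Rightarrow> real" where
  "dist2 n x y = (\<Sum>i<n. (x i - y i)\<^sup>2)"

text \<open>Convex combination of the thresholdings at the two ends of an interval around the exact
  threshold; \<open>c\<close> is the weight of the lower end.\<close>

definition mix :: "point \<Rightarrow> real \<Rightarrow> real \<Rightarrow> real \<Rightarrow> point" where
  "mix z lo hi c = (\<lambda>i. (1 - c) * max 0 (z i - hi) + c * max 0 (z i - lo))"

lemma dist2_nonneg: "0 \<le> dist2 n x y"
  by (simp add: dist2_def sum_nonneg)

lemma dist2_coords: "dist2 n (coords n x) y = dist2 n x y"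
  by (simp add: dist2_def coords_def)

lemma mem_unit_simplex:
  "x \<in> unit_simplex n \<longleftrightarrow> (\<forall>i\<ge>n. x i = 0) \<and> (\<Sum>i<n. x i) = 1 \<and> (\<forall>i<n. 0 \<le> x i)"
  by (simp add: unit_simplex_def topspace_Euclidean_space)

lemma coords_in_simplex:
  "coords n x \<in> unit_simplex n \<longleftrightarrow> (\<Sum>i<n. x i) = 1 \<and> (\<forall>i<n. 0 \<le> x i)"
  by (auto simp: mem_unit_simplex coords_def)

text \<open>Settles dimension 1, where no inequality between \<open>H\<close> and \<open>G\<close>
  is available.\<close>

lemma simplex_one_point:
  assumes "x \<in> unit_simplex (Suc 0)" "y \<in> unit_simplex (Suc 0)"
  shows "x = y"
proof
  fix i
  from assms show "x i = y i"
    by (cases i) (auto simp: mem_unit_simplex)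
qed

text \<open>The mass of \<open>mix\<close> is affine in the weight, and the quotient solves
  \<open>(1 - c) * B + c * A = 1\<close>.\<close>

lemma mix_sum:
  fixes n :: nat and z :: point and lo hi :: real
  defines "A \<equiv> pos_sum n z lo" and "B \<equiv> pos_sum n z hi"
  assumes "1 \<le> A" "B \<le> 1"
  shows "(\<Sum>i<n. mix z lo hi ((1 - B) / (A - B)) i) = 1"
    and "0 \<le> (1 - B) / (A - B)" and "(1 - B) / (A - B) \<le> 1"
proof -
  let ?c = "(1 - B) / (A - B)"
  have "(\<Sum>i<n. mix z lo hi ?c i) = (1 - ?c) * B + ?c * A"
    by (simp add: mix_def A_def B_def pos_sum_def sum.distrib sum_distrib_left)
  also have "\<dots> = B + ?c * (A - B)"
    by (simp only: left_diff_distrib right_diff_distrib mult_1_left)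
  \<comment> \<open>If \<open>A = B\<close>, both equal 1, and the quotient is 0 by the convention
    for division by zero; the sum is still 1.\<close>
  also have "\<dots> = 1"
    using assms(3,4) by (cases "A = B") auto
  finally show "(\<Sum>i<n. mix z lo hi ?c i) = 1" .
  show "0 \<le> ?c" "?c \<le> 1"
    using assms(3,4) by (auto simp: divide_simps)
qed

text \<open>Optimality of the exact projection fails by at most \<open>hi - lo\<close>: with \<open>r = z - hi - x\<close> one has
  \<open>r \<le> 0\<close> everywhere and \<open>r \<ge> lo - hi\<close> on the support of \<open>x\<close>, and \<open>x\<close> has total mass 1.  The
  bound is independent of the dimension.\<close>

lemma dist2_mix:
  assumes u: "u \<in> unit_simplex n"
    and x: "x = mix z lo hi c" "(\<Sum>i<n. x i) = 1"
    and c: "0 \<le> c" "c \<le> 1" and "lo \<le> hi"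
  shows "dist2 n x u \<le> dist2 n z u + 2 * (hi - lo)"
proof -
  define r where "r i = z i - hi - x i" for i
  have x0: "0 \<le> x i" for i
    using c by (simp add: x(1) mix_def)
  have lower: "max 0 (z i - hi) \<le> x i" for i
  proof -
    have "0 \<le> c * (max 0 (z i - lo) - max 0 (z i - hi))"
      using c \<open>lo \<le> hi\<close> by (intro mult_nonneg_nonneg) auto
    then show ?thesis by (simp add: x(1) mix_def algebra_simps)
  qed
  have upper: "x i \<le> max 0 (z i - lo)" for i
  proof -
    have "0 \<le> (1 - c) * (max 0 (z i - lo) - max 0 (z i - hi))"
      using c \<open>lo \<le> hi\<close> by (intro mult_nonneg_nonneg) auto
    then show ?thesis by (simp add: x(1) mix_def algebra_simps)
  qed
  have r0: "r i \<le> 0" for i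
    using lower[of i] by (simp add: r_def)
  have r1: "- r i * x i \<le> (hi - lo) * x i" for i
  proof (cases "x i = 0")
    case False
    with x0[of i] have "0 < x i" by simp
    with upper[of i] have "- r i \<le> hi - lo" by (auto simp: r_def max_def split: if_splits)
    then show ?thesis by (rule mult_right_mono) (rule x0)
  qed simp
  have "(z i - u i)\<^sup>2 - (x i - u i)\<^sup>2 \<ge> 2 * hi * (x i - u i) - 2 * (hi - lo) * x i" if "i < n" for i
  proof -
    have ui: "0 \<le> u i" using u that by (simp add: mem_unit_simplex)
    have "(z i - u i)\<^sup>2 - (x i - u i)\<^sup>2 = (z i - x i)\<^sup>2 + 2 * (r i + hi) * (x i - u i)"
      by (simp add: r_def power2_eq_square algebra_simps)
    also have "\<dots> \<ge> 2 * (r i + hi) * (x i - u i)" by simp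
    also have "2 * (r i + hi) * (x i - u i) = 2 * hi * (x i - u i) + 2 * (r i * x i) - 2 * (r i * u i)"
      by (simp add: algebra_simps)
    moreover have "r i * u i \<le> 0" using r0 ui by (simp add: mult_le_0_iff)
    moreover have "2 * (r i * x i) \<ge> - 2 * (hi - lo) * x i"
      using r1[of i] by (simp add: left_diff_distrib right_diff_distrib)
    ultimately show ?thesis by linarith
  qed
  then have "(\<Sum>i<n. (z i - u i)\<^sup>2 - (x i - u i)\<^sup>2) \<ge> (\<Sum>i<n. 2 * hi * (x i - u i) - 2 * (hi - lo) * x i)"
    by (intro sum_mono) auto
  also have "(\<Sum>i<n. 2 * hi * (x i - u i) - 2 * (hi - lo) * x i)
      = 2 * hi * ((\<Sum>i<n. x i) - (\<Sum>i<n. u i)) - 2 * (hi - lo) * (\<Sum>i<n. x i)"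
    by (simp add: sum_subtractf sum_distrib_left right_diff_distrib)
  \<comment> \<open>The multiple of \<open>hi\<close> cancels, as \<open>x\<close> and
    \<open>u\<close> both have mass 1.\<close>
  also have "\<dots> = - 2 * (hi - lo)"
    using u x(2) by (simp add: mem_unit_simplex)
  finally show ?thesis by (simp add: dist2_def sum_subtractf)
qed

text \<open>Supplies the first bisection interval: lowering the threshold to \<open>- M\<close>
  makes up for any decrease of a coordinate, and raising it to \<open>M\<close> for any
  increase.\<close>

lemma pos_sum_gradient_step:
  assumes x: "coords n x \<in> unit_simplex n" and v: "\<And>i. i < n \<Longrightarrow> \<bar>v i\<bar> \<le> M"
  shows "1 \<le> pos_sum n (\<lambda>i. x i - v i) (- M)" "pos_sum n (\<lambda>i. x i - v i) M \<le> 1"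
proof -
  have *: "(\<Sum>i<n. x i) = 1" "\<forall>i<n. 0 \<le> x i" using x by (simp_all add: coords_in_simplex)
  have "(\<Sum>i<n. x i) \<le> pos_sum n (\<lambda>i. x i - v i) (- M)"
    unfolding pos_sum_def by (intro sum_mono) (use v in \<open>force simp: abs_le_iff\<close>)
  moreover have "pos_sum n (\<lambda>i. x i - v i) M \<le> (\<Sum>i<n. x i)"
    unfolding pos_sum_def by (intro sum_mono) (use v * in \<open>force simp: abs_le_iff\<close>)
  ultimately show "1 \<le> pos_sum n (\<lambda>i. x i - v i) (- M)" "pos_sum n (\<lambda>i. x i - v i) M \<le> 1"
    using * by simp_all
qed

section \<open>Second-order expansion along segments\<close>

text \<open>Chain rule for a line, taken directly from the difference quotient: along the line the
  distance in the denominator is \<open>\<bar>\<sigma> - \<tau>\<bar>\<close> times the norm of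
  \<open>d\<close>.\<close>

lemma has_gradient_line:
  fixes x d :: point and \<tau> :: real
  assumes "has_gradient n F v (\<lambda>i. x i + \<tau> * d i)" "\<And>i. n \<le> i \<Longrightarrow> x i = 0" "\<And>i. n \<le> i \<Longrightarrow> d i = 0"
  shows "((\<lambda>\<tau>. F (\<lambda>i. x i + \<tau> * d i)) has_real_derivative (\<Sum>i<n. v i * d i)) (at \<tau>)"
proof (cases "\<forall>i<n. d i = 0")
  \<comment> \<open>For \<open>d = 0\<close> the line is constant and violates \<open>ne\<close>
    below, which the punctured limit requires.\<close>
  case True
  then have "d = (\<lambda>_. 0)" using assms(3) by (metis linorder_not_less)
  then show ?thesis by simp
next
  case False
  define y where "y \<tau> = (\<lambda>i. x i + \<tau> * d i)" for \<tau> :: real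
  have N: "L2_set d {..<n} > 0"
    using False by (metis L2_set_eq_0_iff L2_set_nonneg finite_lessThan lessThan_iff less_eq_real_def)
  have "continuous_on UNIV y"
    unfolding y_def by (intro continuous_on_coordinatewise_then_product continuous_intros)
  then have y_tendsto: "(y \<longlongrightarrow> y \<tau>) (at \<tau>)"
    by (simp add: continuous_on_def)
  have ne: "y \<sigma> \<noteq> y \<tau>" if "\<sigma> \<noteq> \<tau>" for \<sigma>
    using False that by (auto simp: y_def fun_eq_iff)
  have y_filterlim: "filterlim y (at (y \<tau>) within topspace (Euclidean_space n)) (at \<tau>)"
    using y_tendsto ne assms(2,3)
    by (auto simp: filterlim_at eventually_at_filter y_def topspace_Euclidean_space)
  have "((\<lambda>\<sigma>. (F (y \<sigma>) - F (y \<tau>) - (\<Sum>i<n. v i * (y \<sigma> i - y \<tau> i)))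
         / L2_set (\<lambda>i. y \<sigma> i - y \<tau> i) {..<n}) \<longlongrightarrow> 0) (at \<tau>)"
    by (rule filterlim_compose[OF _ y_filterlim])
       (use assms(1) in \<open>simp add: has_gradient_def y_def\<close>)
  moreover have "L2_set (\<lambda>i. y \<sigma> i - y \<tau> i) {..<n} = \<bar>\<sigma> - \<tau>\<bar> * L2_set d {..<n}" for \<sigma>
  proof -
    have "(\<lambda>i. y \<sigma> i - y \<tau> i) = (\<lambda>i. (\<sigma> - \<tau>) * d i)" by (simp add: y_def algebra_simps)
    then show ?thesis
      by (simp add: L2_set_def power_mult_distrib real_sqrt_mult flip: sum_distrib_left)
  qed
  moreover have "(\<Sum>i<n. v i * (y \<sigma> i - y \<tau> i)) = (\<sigma> - \<tau>) * (\<Sum>i<n. v i * d i)" for \<sigma>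
    unfolding sum_distrib_left by (intro sum.cong refl) (simp add: y_def algebra_simps)
  ultimately have "((\<lambda>\<sigma>. L2_set d {..<n} * ((F (y \<sigma>) - F (y \<tau>) - (\<sigma> - \<tau>) * (\<Sum>i<n. v i * d i))
         / (\<bar>\<sigma> - \<tau>\<bar> * L2_set d {..<n}))) \<longlongrightarrow> L2_set d {..<n} * 0) (at \<tau>)"
    by (intro tendsto_mult tendsto_const) simp
  then have "((\<lambda>\<sigma>. (F (y \<sigma>) - F (y \<tau>) - (\<sigma> - \<tau>) * (\<Sum>i<n. v i * d i)) / \<bar>\<sigma> - \<tau>\<bar>) \<longlongrightarrow> 0) (at \<tau>)"
    using N by simp
  \<comment> \<open>Absolute values remove the difference between dividing by
    \<open>\<sigma> - \<tau>\<close> and by its modulus.\<close>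
  then have "((\<lambda>\<sigma>. \<bar>(F (y \<sigma>) - F (y \<tau>)) / (\<sigma> - \<tau>) - (\<Sum>i<n. v i * d i)\<bar>) \<longlongrightarrow> 0) (at \<tau>)"
  proof (rule Lim_transform_eventually[OF tendsto_rabs_zero])
    have "\<bar>(a - (\<sigma> - \<tau>) * b) / \<bar>\<sigma> - \<tau>\<bar>\<bar> = \<bar>a / (\<sigma> - \<tau>) - b\<bar>" if "\<sigma> \<noteq> \<tau>" for a b \<sigma> :: real
    proof -
      have "a / (\<sigma> - \<tau>) - b = (a - (\<sigma> - \<tau>) * b) / (\<sigma> - \<tau>)"
        using that by (simp add: diff_divide_distrib)
      then show ?thesis by (simp add: abs_divide)
    qed
    then show "\<forall>\<^sub>F \<sigma> in at \<tau>. \<bar>(F (y \<sigma>) - F (y \<tau>) - (\<sigma> - \<tau>) * (\<Sum>i<n. v i * d i)) / \<bar>\<sigma> - \<tau>\<bar>\<bar>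
        = \<bar>(F (y \<sigma>) - F (y \<tau>)) / (\<sigma> - \<tau>) - (\<Sum>i<n. v i * d i)\<bar>"
      by (simp add: eventually_at_filter)
  qed
  then show ?thesis
    unfolding has_field_derivative_iff y_def
    by (simp add: tendsto_rabs_zero_iff LIM_zero_iff)
qed

text \<open>Taylor's formula of order 2 on the segment from \<open>x\<close> to \<open>u\<close>.
  The Lagrange remainder involves the Hessian at a single point of the segment, so existence of the
  second derivatives suffices.\<close>

lemma strong_convexity:
  assumes smooth: "twice_differentiable_near n (unit_simplex n) F g h"
    and hess: "\<And>y. y \<in> unit_simplex n \<Longrightarrow> psd n (\<lambda>i l. h y i l - H * (if i = l then 1 else 0))"
    and x: "x \<in> unit_simplex n" and u: "u \<in> unit_simplex n"
  shows "F u \<ge> F x + (\<Sum>i<n. g x i * (u i - x i)) + H / 2 * dist2 n u x"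
proof -
  define d where "d i = u i - x i" for i
  define y where "y \<tau> = (\<lambda>i. x i + \<tau> * d i)" for \<tau> :: real
  have y_in: "y \<tau> \<in> unit_simplex n" if "0 \<le> \<tau>" "\<tau> \<le> 1" for \<tau>
  proof -
    have "y \<tau> i = (1 - \<tau>) * x i + \<tau> * u i" for i by (simp add: y_def d_def algebra_simps)
    with x u that show ?thesis
      by (simp add: mem_unit_simplex sum.distrib flip: sum_distrib_left)
  qed
  have outside: "x i = 0" "d i = 0" if "n \<le> i" for i
    using x u that by (simp_all add: mem_unit_simplex d_def)
  have grad: "has_gradient n F (g (y \<tau>)) (y \<tau>)"
    and hessian: "\<And>i. i < n \<Longrightarrow> has_gradient n (\<lambda>z. g z i) (h (y \<tau>) i) (y \<tau>)"
    if "0 \<le> \<tau>" "\<tau> \<le> 1" for \<tau>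
    using smooth y_in[OF that] unfolding twice_differentiable_near_def by blast+
  have D1: "((\<lambda>\<tau>. F (y \<tau>)) has_real_derivative (\<Sum>i<n. g (y \<tau>) i * d i)) (at \<tau>)"
    if "0 \<le> \<tau>" "\<tau> \<le> 1" for \<tau>
    using has_gradient_line[OF grad[OF that, unfolded y_def] outside] by (simp add: y_def)
  have "((\<lambda>\<tau>. g (y \<tau>) i) has_real_derivative (\<Sum>l<n. h (y \<tau>) i l * d l)) (at \<tau>)"
    if "0 \<le> \<tau>" "\<tau> \<le> 1" "i < n" for \<tau> i
    using has_gradient_line[OF hessian[OF that, unfolded y_def] outside] by (simp add: y_def)
  then have D2: "((\<lambda>\<tau>. \<Sum>i<n. g (y \<tau>) i * d i) has_real_derivative
      (\<Sum>i<n. (\<Sum>l<n. h (y \<tau>) i l * d l) * d i)) (at \<tau>)" if "0 \<le> \<tau>" "\<tau> \<le> 1" for \<tau>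
    by (intro DERIV_sum DERIV_cmult_right) (use that in auto)
  \<comment> \<open>\<open>diff m\<close> is the derivative of order \<open>m\<close> of
    \<open>\<lambda>\<tau>. F (y \<tau>)\<close> for \<open>m \<le> 2\<close>, the orders that occur
    in the formula.\<close>
  define diff where "diff m \<tau> = (if m = 0 then F (y \<tau>) else if m = 1 then (\<Sum>i<n. g (y \<tau>) i * d i)
      else (\<Sum>i<n. (\<Sum>l<n. h (y \<tau>) i l * d l) * d i))" for m :: nat and \<tau>
  have "\<exists>t>0. t < 1 \<and> F (y 1) = (\<Sum>m<2. diff m 0 / fact m * (1 - 0) ^ m) + diff 2 t / fact 2 * (1 - 0) ^ 2"
  proof (rule Taylor_up)
    show "\<forall>m t. m < 2 \<and> 0 \<le> t \<and> t \<le> 1 \<longrightarrow> DERIV (diff m) t :> diff (Suc m) t"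
      unfolding diff_def using D1 D2 by (auto simp: less_2_cases_iff)
  qed (auto simp: diff_def)
  then obtain t where t: "0 < t" "t < 1"
    and F: "F (y 1) = F (y 0) + (\<Sum>i<n. g (y 0) i * d i)
       + (\<Sum>i<n. (\<Sum>l<n. h (y t) i l * d l) * d i) / 2"
    by (auto simp: diff_def eval_nat_numeral)
  have "0 \<le> (\<Sum>i<n. \<Sum>l<n. d i * (h (y t) i l - H * (if i = l then 1 else 0)) * d l)"
    using hess[OF y_in[of t]] t unfolding psd_def by auto
  also have "\<dots> = (\<Sum>i<n. \<Sum>l<n. h (y t) i l * d l * d i - (if i = l then H * (d i)\<^sup>2 else 0))"
    by (intro sum.cong refl) (simp add: power2_eq_square algebra_simps)
  also have "\<dots> = (\<Sum>i<n. (\<Sum>l<n. h (y t) i l * d l) * d i)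
      - (\<Sum>i<n. \<Sum>l<n. if i = l then H * (d i)\<^sup>2 else 0)"
    by (simp only: sum_subtractf sum_distrib_right)
  also have "(\<Sum>i<n. \<Sum>l<n. if i = l then H * (d i)\<^sup>2 else 0) = H * dist2 n u x"
    by (simp add: dist2_def d_def sum_distrib_left)
  finally have "H / 2 * dist2 n u x \<le> (\<Sum>i<n. (\<Sum>l<n. h (y t) i l * d l) * d i) / 2"
    by simp
  moreover have "y 0 = x" "y 1 = u" by (simp_all add: y_def d_def)
  ultimately show ?thesis using F by (simp add: d_def)
qed

text \<open>Strong convexity between two vertices, added in both directions: the function values
  cancel, the squared distance is 2, and four gradient entries of modulus at most \<open>G\<close>
  remain.\<close>

lemma curvature_le_gradient:
  assumes n: "2 \<le> n"
    and F: "\<And>x u. x \<in> unit_simplex n \<Longrightarrow> u \<in> unit_simplex n \<Longrightarrow>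
              F u \<ge> F x + (\<Sum>i<n. g x i * (u i - x i)) + H / 2 * dist2 n u x"
    and G: "\<And>x i. x \<in> unit_simplex n \<Longrightarrow> i < n \<Longrightarrow> \<bar>g x i\<bar> \<le> G"
  shows "H \<le> 2 * G"
proof -
  define e where "e k = (\<lambda>i. if i = k then 1 else 0 :: real)" for k :: nat
  have e_in: "e 0 \<in> unit_simplex n" "e 1 \<in> unit_simplex n"
    using n by (auto simp: mem_unit_simplex e_def)
  have split: "(\<Sum>i<n. a i) = a 0 + a 1 + (\<Sum>i\<in>{2..<n}. a i)" for a :: "nat \<Rightarrow> real"
  proof -
    have "{..<n} = insert 0 (insert 1 {2..<n})" using n by auto
    then show ?thesis by simp
  qed
  have "F (e 1) \<ge> F (e 0) + (g (e 0) 1 - g (e 0) 0) + H"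
    using F[OF e_in] by (simp add: split dist2_def) (simp add: e_def)
  moreover have "F (e 0) \<ge> F (e 1) + (g (e 1) 0 - g (e 1) 1) + H"
    using F[OF e_in(2,1)] by (simp add: split dist2_def) (simp add: e_def)
  moreover have "\<bar>g (e 0) 0\<bar> \<le> G" "\<bar>g (e 0) 1\<bar> \<le> G" "\<bar>g (e 1) 0\<bar> \<le> G" "\<bar>g (e 1) 1\<bar> \<le> G"
    using G e_in n by auto
  ultimately show ?thesis by linarith
qed

section \<open>One weighted gradient step\<close>

text \<open>Expanding the squared distance after the step produces the linear term of the strong
  convexity bound. The coefficient \<open>H * (r - 1) * r / 4\<close> of the old distance is that of
  the new distance one round earlier, which makes the sum over the rounds telescope.\<close>

lemma gradient_step_bound:
  fixes x u v :: point and r H \<epsilon> G :: real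
  defines "\<eta> \<equiv> 2 / (H * (r + 1))"
  assumes "0 < r" "0 < H"
    and conv: "Fu \<ge> Fx + (\<Sum>i<n. v i * (u i - x i)) + H / 2 * dist2 n u x"
    and "\<epsilon> \<le> Fx" and v: "L2_set v {..<n} \<le> G"
  shows "r * Fu \<ge> r * \<epsilon> + H * r * (r + 1) / 4 * dist2 n (\<lambda>i. x i - \<eta> * v i) u
           - H * (r - 1) * r / 4 * dist2 n x u - G\<^sup>2 / H"
proof -
  let ?D = "dist2 n x u" and ?E = "dist2 n (\<lambda>i. x i - \<eta> * v i) u" and ?L = "\<Sum>i<n. v i * (u i - x i)"
  define V where "V = (\<Sum>i<n. (v i)\<^sup>2)"
  have V: "0 \<le> V" "V \<le> G\<^sup>2"
  proof -
    show "0 \<le> V" unfolding V_def by (simp add: sum_nonneg)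
    have "sqrt V \<le> G" using v by (simp add: V_def L2_set_def)
    then have "sqrt V ^ 2 \<le> G\<^sup>2" using \<open>0 \<le> V\<close> by (intro power_mono) auto
    then show "V \<le> G\<^sup>2" using \<open>0 \<le> V\<close> by simp
  qed
  have E: "?E = ?D + 2 * \<eta> * ?L + \<eta>\<^sup>2 * V"
    unfolding dist2_def V_def sum_distrib_left sum.distrib[symmetric]
    by (intro sum.cong refl) (simp add: power2_eq_square algebra_simps)
  have "dist2 n u x = ?D" unfolding dist2_def by (intro sum.cong refl power2_commute)
  with conv \<open>\<epsilon> \<le> Fx\<close> have "r * Fu \<ge> r * (\<epsilon> + ?L + H / 2 * ?D)"
    using \<open>0 < r\<close> by (intro mult_left_mono) auto
  moreover have "H * r * (r + 1) / 4 * ?E = H * r * (r + 1) / 4 * ?D + r * ?L + r / (H * (r + 1)) * V"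
  proof -
    \<comment> \<open>The step size \<eta> is chosen for the first equation: the linear term then
      occurs with the weight \<open>r\<close>.\<close>
    have "H * r * (r + 1) / 4 * (2 * \<eta>) = r" "H * r * (r + 1) / 4 * \<eta>\<^sup>2 = r / (H * (r + 1))"
      using assms(2,3) by (simp_all add: \<eta>_def divide_simps power2_eq_square)
    moreover have "c * ?E = c * ?D + (c * (2 * \<eta>)) * ?L + (c * \<eta>\<^sup>2) * V" for c
      unfolding E by (simp add: algebra_simps)
    ultimately show ?thesis by metis
  qed
  moreover have "r / (H * (r + 1)) * V \<le> G\<^sup>2 / H"
  proof -
    have "r / (H * (r + 1)) * V \<le> 1 / H * G\<^sup>2"
      using assms(2,3) V by (intro mult_mono) (auto simp: divide_simps)
    then show ?thesis by simp
  qed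
  moreover have "r * (\<epsilon> + ?L + H / 2 * ?D) = r * \<epsilon> + r * ?L + H * r * (r + 1) / 4 * ?D - H * (r - 1) * r / 4 * ?D"
    by (simp add: field_simps)
  ultimately show ?thesis by linarith
qed

text \<open>\<open>K\<close> is the least positive exponent with \<open>16 * X \<le> 2 ^ K\<close>,
  which is the number of bisection steps per projection. By minimality
  \<open>2 ^ (K - 1) < 16 * X\<close>, hence the logarithmic bound.\<close>

lemma doubling_number:
  fixes X :: real
  obtains K :: nat where "1 \<le> K" "16 * X \<le> 2 ^ K" "\<And>b. 1 \<le> b \<Longrightarrow> b < K \<Longrightarrow> 2 ^ b < 16 * X"
    "real K \<le> 5 * (1 + ln (max 1 X))"
proof -
  let ?P = "\<lambda>K. 1 \<le> K \<and> 16 * X \<le> 2 ^ K"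
  define K where "K = (LEAST K. ?P K)"
  obtain K0 where K0: "16 * X < 2 ^ K0" using real_arch_pow[of 2 "16 * X"] by auto
  also have "(2::real) ^ K0 \<le> 2 ^ Suc K0" by simp
  finally have "?P (Suc K0)" by simp
  then have K: "?P K" unfolding K_def by (rule LeastI)
  have below: "2 ^ b < 16 * X" if "1 \<le> b" "b < K" for b
    using not_less_Least[of b ?P] that unfolding K_def by auto
  define L where "L = ln (max 1 X)"
  have L: "0 \<le> L" by (simp add: L_def)
  have "real K \<le> 5 * (1 + ln (max 1 X))"
  proof (cases "K = 1")
    case False
    with K have "2 \<le> K" by simp
    then have less: "2 ^ (K - 1) < 16 * X" by (intro below) auto
    have "0 < X" using less zero_less_power[of "2::real" "K - 1"] by linarith
    have "real (K - 1) * ln 2 = ln (2 ^ (K - 1))" by (simp add: ln_realpow)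
    \<comment> \<open>Writing 16 as a power of 2 turns the constant into a shift of
      \<open>K - 1\<close> by 4.\<close>
    also have "\<dots> \<le> ln (2 ^ 4 * X)" using less \<open>0 < X\<close> by (subst ln_le_cancel_iff) auto
    also have "\<dots> = 4 * ln 2 + ln X" using \<open>0 < X\<close> ln_realpow[of 2 4] by (simp add: ln_mult)
    finally have "(real (K - 1) - 4) * ln 2 \<le> ln X" by (simp add: algebra_simps)
    also have "ln X \<le> ln (max 1 X)" using \<open>0 < X\<close> by simp
    also have "\<dots> = L" by (simp add: L_def)
    finally have A: "(real K - 5) * ln 2 \<le> L" using \<open>2 \<le> K\<close> by simp
    have "real K \<le> 5 + 2 * L"
    proof (cases "real K \<le> 5")
      case False
      then have "(real K - 5) * (1 / 2) \<le> (real K - 5) * ln 2"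
        using ln2_ge_two_thirds by (intro mult_left_mono) auto
      with A show ?thesis by simp
    qed (use L in simp)
    then show ?thesis using L unfolding L_def[symmetric] by (simp add: algebra_simps)
  qed simp
  with K below that show ?thesis by blast
qed

section \<open>Running programs\<close>

text \<open>\<open>b\<close> bounds the ticks and \<open>d\<close> the gradient calls. Upper bounds
  instead of exact counts allow the costs to be rounded to simple expressions in the
  dimension.\<close>

definition steps ::
  "nat \<Rightarrow> (nat \<Rightarrow> point \<Rightarrow> 'j option) \<Rightarrow> ('j \<Rightarrow> point \<Rightarrow> point) \<Rightarrow>
   com \<Rightarrow> 'j state \<Rightarrow> nat \<Rightarrow> nat \<Rightarrow> 'j state \<Rightarrow> bool" where
  "steps n orc g c s b d s' \<longleftrightarrow> (\<exists>t. exec n orc g c s t s' \<and> Oracle_Call \<notin> set t \<and>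
     count_list t Gradient_Call \<le> d \<and> count_list t Tick \<le> b)"

lemma count_list_replicate: "count_list (replicate k x) y = (if x = y then k else 0)"
  by (induction k) auto

lemma steps_mono: "steps n orc g c s b d s' \<Longrightarrow> b \<le> b' \<Longrightarrow> d \<le> d' \<Longrightarrow> steps n orc g c s b' d' s'"
  unfolding steps_def by (meson le_trans)

lemma steps_Seq:
  assumes "steps n orc g c1 s b1 d1 s1" "steps n orc g c2 s1 b2 d2 s2"
  shows "steps n orc g (Seq c1 c2) s (b1 + b2) (d1 + d2) s2"
proof -
  from assms obtain t1 t2 where
    "exec n orc g c1 s t1 s1" "Oracle_Call \<notin> set t1" "count_list t1 Gradient_Call \<le> d1"
    "count_list t1 Tick \<le> b1"
    "exec n orc g c2 s1 t2 s2" "Oracle_Call \<notin> set t2" "count_list t2 Gradient_Call \<le> d2"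
    "count_list t2 Tick \<le> b2"
    unfolding steps_def by blast
  then show ?thesis unfolding steps_def
    by (intro exI[of _ "t1 @ t2"]) (auto intro: exec_Seq)
qed

lemma steps_Cond:
  assumes "steps n orc g (if bval s e then c1 else c2) s b d s'"
  shows "steps n orc g (Cond e c1 c2) s (bcost e + 1 + b) d s'"
proof -
  from assms obtain t where t:
    "exec n orc g (if bval s e then c1 else c2) s t s'" "Oracle_Call \<notin> set t"
    "count_list t Gradient_Call \<le> d" "count_list t Tick \<le> b"
    unfolding steps_def by blast
  then have "exec n orc g (Cond e c1 c2) s (replicate (bcost e + 1) Tick @ t) s'"
    by (cases "bval s e") (auto intro: exec_CondTrue[simplified] exec_CondFalse[simplified])
  then show ?thesis unfolding steps_def
    using t by (intro exI[of _ "replicate (bcost e + 1) Tick @ t"]) (auto simp: count_list_replicate)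
qed

lemma steps_While_False: "\<not> bval s e \<Longrightarrow> steps n orc g (While e c) s (bcost e + 1) 0 s"
  unfolding steps_def
  by (intro exI[of _ "replicate (bcost e + 1) Tick"] conjI exec_WhileFalse)
     (auto simp: count_list_replicate)

lemma steps_While_True:
  assumes "bval s e" "steps n orc g c s b1 0 s1" "steps n orc g (While e c) s1 b2 0 s2"
  shows "steps n orc g (While e c) s (bcost e + 1 + b1 + b2) 0 s2"
proof -
  from assms obtain t1 t2 where
    "exec n orc g c s t1 s1" "Oracle_Call \<notin> set t1" "count_list t1 Gradient_Call \<le> 0"
    "count_list t1 Tick \<le> b1"
    "exec n orc g (While e c) s1 t2 s2" "Oracle_Call \<notin> set t2" "count_list t2 Gradient_Call \<le> 0"
    "count_list t2 Tick \<le> b2"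
    unfolding steps_def by blast
  with assms(1) show ?thesis unfolding steps_def
    by (intro exI[of _ "replicate (bcost e + 1) Tick @ t1 @ t2"] conjI exec_WhileTrue)
       (auto simp: count_list_replicate)
qed

text \<open>\<open>run\<close> and \<open>cost\<close> have junk values on commands that are not \<open>simple\<close>; \<open>cost\<close> charges both
  branches of a conditional.\<close>

primrec simple :: "com \<Rightarrow> bool" where
  "simple Skip = True"
| "simple (NPut a e v) = True"
| "simple (RPut a e v) = True"
| "simple (Seq c1 c2) = (simple c1 \<and> simple c2)"
| "simple (Cond b c1 c2) = (simple c1 \<and> simple c2)"
| "simple (While b c) = False"
| "simple (Query a d) = False"
| "simple (Grad e a d) = False"

primrec run :: "com \<Rightarrow> 'j state \<Rightarrow> 'j state" where
  "run Skip s = s"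
| "run (NPut a e v) s = s\<lparr>nats := (nats s)(a := (nats s a)(nval s e := nval s v))\<rparr>"
| "run (RPut a e v) s = s\<lparr>reals := (reals s)(a := (reals s a)(nval s e := rval s v))\<rparr>"
| "run (Seq c1 c2) s = run c2 (run c1 s)"
| "run (Cond b c1 c2) s = (if bval s b then run c1 s else run c2 s)"
| "run (While b c) s = s"
| "run (Query a d) s = s"
| "run (Grad e a d) s = s"

primrec cost :: "com \<Rightarrow> nat" where
  "cost Skip = 1"
| "cost (NPut a e v) = ncost e + ncost v + 1"
| "cost (RPut a e v) = ncost e + rcost v + 1"
| "cost (Seq c1 c2) = cost c1 + cost c2"
| "cost (Cond b c1 c2) = bcost b + 1 + (cost c1 + cost c2)"
| "cost (While b c) = 0"
| "cost (Query a d) = 0"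
| "cost (Grad e a d) = 0"

lemma steps_run: "simple c \<Longrightarrow> steps n orc g c s (cost c) 0 (run c s)"
proof (induction c arbitrary: s)
  case Skip
  then show ?case unfolding steps_def by (auto intro!: exI[of _ "[Tick]"] exec_Skip)
next
  case (NPut a e v)
  then show ?case unfolding steps_def
    by (intro exI[of _ "replicate (ncost e + ncost v + 1) Tick"])
       (auto simp: count_list_replicate intro: exec_NPut[simplified])
next
  case (RPut a e v)
  then show ?case unfolding steps_def
    by (intro exI[of _ "replicate (ncost e + rcost v + 1) Tick"])
       (auto simp: count_list_replicate intro: exec_RPut[simplified])
next
  case (Seq c1 c2)
  then show ?case using steps_Seq[OF Seq.IH(1)[of s] Seq.IH(2)[of "run c1 s"]] by simp
next
  case (Cond b c1 c2)
  then have "steps n orc g (if bval s b then c1 else c2) s (cost c1 + cost c2) 0 (run (Cond b c1 c2) s)"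
    by (auto intro: steps_mono[OF Cond.IH(1)] steps_mono[OF Cond.IH(2)])
  from steps_Cond[OF this] show ?case by simp
qed simp_all

lemma steps_runI:
  "simple c \<Longrightarrow> run c s = s' \<Longrightarrow> cost c \<le> b \<Longrightarrow> steps n orc g c s b d s'"
  using steps_run steps_mono by blast

abbreviation nvar :: "nat \<Rightarrow> nexp" where "nvar c \<equiv> NGet 0 (NConst c)"
abbreviation rvar :: "nat \<Rightarrow> rexp" where "rvar c \<equiv> RGet 0 (NConst c)"
abbreviation rat :: "nat \<Rightarrow> rexp" where "rat a \<equiv> RGet a (nvar 2)"
abbreviation rnum :: "nat \<Rightarrow> rexp" where "rnum c \<equiv> RNat (NConst c)"
abbreviation nset :: "nat \<Rightarrow> nexp \<Rightarrow> com" where "nset c \<equiv> NPut 0 (NConst c)"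
abbreviation rset :: "nat \<Rightarrow> rexp \<Rightarrow> com" where "rset c \<equiv> RPut 0 (NConst c)"
abbreviation rput_at :: "nat \<Rightarrow> rexp \<Rightarrow> com" where "rput_at a \<equiv> RPut a (nvar 2)"
notation Seq (infixr ";;" 60)

section \<open>Counting loops\<close>

definition for_loop :: "nat \<Rightarrow> com \<Rightarrow> com" where
  "for_loop m c = nset 2 (NConst 0) ;; While (NLess (nvar 2) (nvar m)) (c ;; nset 2 (NAdd (nvar 2) (NConst 1)))"

text \<open>\<open>st i\<close> is the state after \<open>i\<close> passes, in closed form. Per
  pass, 20 covers the test and the increment; the 10 covers the initialisation and the last, failing
  test.\<close>

lemma steps_for_loop:
  assumes c: "simple c"
    and init: "run (nset 2 (NConst 0)) s = st 0"
    and step: "\<And>i. i < N \<Longrightarrow> run (c ;; nset 2 (NAdd (nvar 2) (NConst 1))) (st i) = st (Suc i)"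
    and bound: "\<And>i. i \<le> N \<Longrightarrow> nats (st i) 0 2 = i \<and> nats (st i) 0 m = N"
  shows "steps n orc g (for_loop m c) s (10 + N * (cost c + 20)) 0 (st N)"
proof -
  let ?b = "NLess (nvar 2) (nvar m)" and ?c = "c ;; nset 2 (NAdd (nvar 2) (NConst 1))"
  \<comment> \<open>The induction runs down from the exit of the loop, since the rule for
    \<open>While\<close> puts one pass in front of the remaining run.\<close>
  have "steps n orc g (While ?b ?c) (st i) ((N - i) * (cost c + 20) + 6) 0 (st N)" if "i \<le> N" for i
    using that
  proof (induction i rule: inc_induct)
    case base
    show ?case using bound[of N]
      by (intro steps_mono[OF steps_While_False]) auto
  next
    case (step i)
    have "steps n orc g ?c (st i) (cost c + 6) 0 (st (Suc i))"
      using steps_run[of ?c n orc g "st i"] c unfolding assms(3)[OF \<open>i < N\<close>]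
      by (simp add: eval_nat_numeral)
    from steps_While_True[OF _ this step.IH]
    have "steps n orc g (While ?b ?c) (st i) (bcost ?b + 1 + (cost c + 6) + ((N - Suc i) * (cost c + 20) + 6)) 0 (st N)"
      using bound[of i] \<open>i < N\<close> by simp
    moreover have "N - i = Suc (N - Suc i)" using \<open>i < N\<close> by simp
    ultimately show ?case by (elim steps_mono) auto
  qed
  from steps_Seq[OF steps_run this[of 0, folded init]]
  have "steps n orc g (for_loop m c) s (cost (nset 2 (NConst 0)) + (N * (cost c + 20) + 6)) 0 (st N)"
    unfolding for_loop_def by simp
  then show ?thesis by (elim steps_mono) auto
qed

definition set_nat :: "nat \<Rightarrow> nat \<Rightarrow> 'j state \<Rightarrow> 'j state" where
  "set_nat c v s = s\<lparr>nats := (nats s)(0 := (nats s 0)(c := v))\<rparr>"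

definition set_real :: "nat \<Rightarrow> real \<Rightarrow> 'j state \<Rightarrow> 'j state" where
  "set_real c v s = s\<lparr>reals := (reals s)(0 := (reals s 0)(c := v))\<rparr>"

definition set_array :: "nat \<Rightarrow> nat \<Rightarrow> (nat \<Rightarrow> real) \<Rightarrow> 'j state \<Rightarrow> 'j state" where
  "set_array a N v s = s\<lparr>reals := (reals s)(a := (\<lambda>i. if i < N then v i else reals s a i))\<rparr>"

lemmas set_defs = set_nat_def set_real_def set_array_def

definition com_pos_sum :: "nat \<Rightarrow> nat \<Rightarrow> com" where
  "com_pos_sum a c = rset c (rnum 0) ;;
     for_loop 0 (Cond (RLess (rvar a) (rat 3)) (rset c (RAdd (rvar c) (RSub (rat 3) (rvar a)))) Skip)"

lemma steps_pos_sum: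
  assumes "nats s 0 0 = N" "a \<noteq> c"
  shows "steps n orc g (com_pos_sum a c) s (20 + N * 50) 0
    (set_nat 2 N (set_real c (pos_sum N (reals s 3) (reals s 0 a)) s))"
proof -
  define st where "st i = set_nat 2 i (set_real c (pos_sum i (reals s 3) (reals s 0 a)) s)" for i
  let ?c = "Cond (RLess (rvar a) (rat 3)) (rset c (RAdd (rvar c) (RSub (rat 3) (rvar a)))) Skip"
  have "steps n orc g (com_pos_sum a c) s
    (cost (rset c (rnum 0)) + (10 + N * (cost ?c + 20))) (0 + 0) (st N)"
    unfolding com_pos_sum_def
  proof (rule steps_Seq[OF steps_run steps_for_loop])
    show "run (nset 2 (NConst 0)) (run (rset c (rnum 0)) s) = st 0"
      by (simp add: st_def set_defs pos_sum_def)
    show "run (?c ;; nset 2 (NAdd (nvar 2) (NConst 1))) (st i) = st (Suc i)" for i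
      using assms by (simp add: st_def set_defs pos_sum_def max_def)
    show "nats (st i) 0 2 = i \<and> nats (st i) 0 0 = N" for i
      using assms by (simp add: st_def set_defs)
  qed auto
  then show ?thesis unfolding st_def by (elim steps_mono) auto
qed

text \<open>\<open>e\<close> is evaluated when exactly the entries below \<open>i\<close> have been
  overwritten, so it may still read entry \<open>i\<close> of the array \<open>a\<close> itself. The
  final normalisation of the weights relies on this.\<close>

lemma steps_array:
  assumes N: "nats s 0 m = N" and m: "m \<noteq> 2" and a: "a \<noteq> 0"
    and e: "\<And>i. i < N \<Longrightarrow> rval (set_nat 2 i (set_array a i v s)) e = v i"
  shows "steps n orc g (for_loop m (rput_at a e)) s (10 + N * (rcost e + 30)) 0
    (set_nat 2 N (set_array a N v s))"
proof -
  define st where "st i = set_nat 2 i (set_array a i v s)" for i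
  have "steps n orc g (for_loop m (rput_at a e)) s (10 + N * (cost (rput_at a e) + 20)) 0 (st N)"
  proof (rule steps_for_loop)
    show "run (nset 2 (NConst 0)) s = st 0"
      by (simp add: st_def set_defs)
    show "run (rput_at a e ;; nset 2 (NAdd (nvar 2) (NConst 1))) (st i) = st (Suc i)" if "i < N" for i
      using e[OF that] by (auto simp: st_def set_defs fun_eq_iff less_Suc_eq)
    show "nats (st i) 0 2 = i \<and> nats (st i) 0 m = N" for i
      using N m by (simp add: st_def set_defs)
  qed auto
  then show ?thesis unfolding st_def by (elim steps_mono) auto
qed

section \<open>Traces cut at the oracle calls\<close>

abbreviation call_segments :: "event list list \<Rightarrow> event list" where
  "call_segments segs \<equiv> concat (map ((#) Oracle_Call) segs)"

lemma append_Cons_inj_first: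
  "xs @ x # ys = xs' @ x # ys' \<Longrightarrow> x \<notin> set xs \<Longrightarrow> x \<notin> set xs' \<Longrightarrow> xs = xs' \<and> ys = ys'"
proof (induction xs arbitrary: xs')
  case Nil
  then show ?case by (cases xs') auto
next
  case (Cons a xs)
  then show ?case by (cases xs') auto
qed

text \<open>\<open>work_bounded\<close> speaks of arbitrary decompositions of the trace; this
  identifies the stretch between two successive calls with one of the known segments.\<close>

lemma between_calls:
  assumes "pre @ call_segments segs @ Oracle_Call # ys = t1 @ [Oracle_Call] @ t2 @ [Oracle_Call] @ t3"
    and "Oracle_Call \<notin> set pre" "\<forall>seg\<in>set segs. Oracle_Call \<notin> set seg"
    and "Oracle_Call \<notin> set ys" "Oracle_Call \<notin> set t2"
  shows "t2 \<in> set segs"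
  using assms
proof (induction segs arbitrary: pre t1)
  case Nil
  \<comment> \<open>Without segments the left side has one call, the right side at least
    two.\<close>
  from arg_cong[OF Nil.prems(1), of "\<lambda>t. count_list t Oracle_Call"] Nil.prems(2,4)
  show ?case by (simp add: count_list_0_iff[THEN iffD2])
next
  case (Cons a segs)
  let ?rest = "call_segments segs @ Oracle_Call # ys"
  have eq: "pre @ Oracle_Call # (a @ ?rest) = t1 @ Oracle_Call # (t2 @ Oracle_Call # t3)"
    using Cons.prems(1) by simp
  show ?case
  proof (cases "Oracle_Call \<in> set t1")
    case False
    with eq Cons.prems(2) have "a @ ?rest = t2 @ Oracle_Call # t3"
      using append_Cons_inj_first by metis
    moreover obtain zs where "?rest = Oracle_Call # zs" by (cases segs) auto
    ultimately have "a = t2"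
      using Cons.prems(3,5) append_Cons_inj_first by (metis list.set_intros(1))
    then show ?thesis by simp
  next
    case True
    then obtain t11 t12 where t1: "t1 = t11 @ Oracle_Call # t12" "Oracle_Call \<notin> set t11"
      by (meson split_list_first)
    \<comment> \<open>Everything up to the first call is removed on both sides, and the first
      segment becomes the new prefix.\<close>
    with eq Cons.prems(2) have "a @ ?rest = t12 @ [Oracle_Call] @ t2 @ [Oracle_Call] @ t3"
      using append_Cons_inj_first[of pre Oracle_Call "a @ ?rest" t11] by auto
    with Cons show ?thesis by auto
  qed
qed

text \<open>The stretch after the last call consists of the last segment and \<open>post\<close>, so
  \<open>C\<close> is split into \<open>B\<close> for the former and \<open>C - B\<close> for the
  latter.\<close>

lemma work_bounded_segments:
  assumes pre: "Oracle_Call \<notin> set pre" "count_list pre Gradient_Call \<le> 1"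
      "real (count_list pre Tick) \<le> C * real n"
    and segs: "segs \<noteq> []"
      "\<And>seg. seg \<in> set segs \<Longrightarrow> Oracle_Call \<notin> set seg \<and> count_list seg Gradient_Call \<le> 1
         \<and> real (count_list seg Tick) \<le> B * real n"
    and post: "Oracle_Call \<notin> set post" "count_list post Gradient_Call = 0"
      "real (count_list post Tick) \<le> (C - B) * (real n + real (length segs))"
    and B: "0 \<le> B" "B \<le> C"
  shows "work_bounded C n (pre @ call_segments segs @ post)"
proof -
  obtain ss l where ss: "segs = ss @ [l]" using segs(1) by (metis rev_exhaust)
  let ?t = "pre @ call_segments ss @ Oracle_Call # (l @ post)"
  have t: "pre @ call_segments segs @ post = ?t" by (simp add: ss)
  have free: "Oracle_Call \<notin> set (l @ post)" using segs(2)[of l] post(1) ss by simp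
  have BC: "B * real n \<le> C * real n" using B by (intro mult_right_mono) auto
  have pre_eq: "takeWhile (\<lambda>e. e \<noteq> Oracle_Call) ?t = pre"
    using pre(1) by (cases ss) (auto simp: takeWhile_append2 takeWhile_tail)
  have post_eq: "takeWhile (\<lambda>e. e \<noteq> Oracle_Call) (rev ?t) = rev (l @ post)"
  proof -
    have "rev ?t = rev (l @ post) @ Oracle_Call # rev (pre @ call_segments ss)" by simp
    moreover have "takeWhile (\<lambda>e. e \<noteq> Oracle_Call) (rev (l @ post) @ Oracle_Call # ys) = rev (l @ post)" for ys
      using free by (subst takeWhile_append2) auto
    ultimately show ?thesis by presburger
  qed
  have calls: "length segs \<le> count_list ?t Oracle_Call"
  proof -
    have "length xs \<le> count_list (call_segments xs) Oracle_Call" for xs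
      by (induction xs) auto
    from this[of segs] show ?thesis unfolding t[symmetric] by simp
  qed
  have "count_list t2 Gradient_Call \<le> 1 \<and> real (count_list t2 Tick) \<le> C * real n"
    if "?t = t1 @ [Oracle_Call] @ t2 @ [Oracle_Call] @ t3" "Oracle_Call \<notin> set t2" for t1 t2 t3
  proof -
    have "t2 \<in> set ss"
      by (rule between_calls[OF that(1) pre(1) _ free that(2)]) (use segs(2) ss in auto)
    then show ?thesis using segs(2)[of t2] ss BC by auto
  qed
  moreover have "real (count_list (rev (l @ post)) Tick) \<le> C * (real n + real (count_list ?t Oracle_Call))"
  proof -
    have "real (count_list (rev (l @ post)) Tick) \<le> B * real n + (C - B) * (real n + real (length segs))"
      using segs(2)[of l] ss post(3) by simp
    also have "\<dots> \<le> B * (real n + real (length segs)) + (C - B) * (real n + real (length segs))"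
      using B by (intro add_right_mono mult_left_mono) auto
    also have "\<dots> = C * (real n + real (length segs))" by (simp add: algebra_simps)
    also have "\<dots> \<le> C * (real n + real (count_list ?t Oracle_Call))"
      using B calls by (intro mult_left_mono) auto
    finally show ?thesis .
  qed
  moreover have "count_list (rev (l @ post)) Gradient_Call \<le> 1"
    using segs(2)[of l] ss post(2) by simp
  ultimately show ?thesis
    using pre(2,3) unfolding work_bounded_def t pre_eq post_eq Let_def by blast
qed

text \<open>The test after a pass is charged to the segment of that pass; only the first test
  precedes all calls. The measure \<open>m\<close> is there because a big-step run exists only if
  the loop terminates.\<close>

lemma exec_While_calls:
  fixes m :: "'j state \<Rightarrow> nat"
  assumes step: "\<And>s. I s \<Longrightarrow> bval s e \<Longrightarrow> \<exists>seg s'. exec n orc g c s (Oracle_Call # seg) s' \<and>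
      Oracle_Call \<notin> set seg \<and> count_list seg Gradient_Call \<le> 1 \<and> count_list seg Tick \<le> B \<and>
      I s' \<and> m s' < m s"
    and "I s"
  shows "\<exists>segs s'. exec n orc g (While e c) s (replicate (bcost e + 1) Tick @ call_segments segs) s' \<and>
      (\<forall>seg\<in>set segs. Oracle_Call \<notin> set seg \<and> count_list seg Gradient_Call \<le> 1 \<and>
         count_list seg Tick \<le> B + (bcost e + 1)) \<and> I s' \<and> \<not> bval s' e"
  using \<open>I s\<close>
proof (induction "m s" arbitrary: s rule: less_induct)
  case less
  show ?case
  proof (cases "bval s e")
    case False
    with less.prems show ?thesis
      by (intro exI[of _ "[]"] exI[of _ s]) (auto intro: exec_WhileFalse[simplified])
  next
    case True
    from step[OF less.prems True] obtain seg s1 where s1: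
      "exec n orc g c s (Oracle_Call # seg) s1" "Oracle_Call \<notin> set seg"
      "count_list seg Gradient_Call \<le> 1" "count_list seg Tick \<le> B" "I s1" "m s1 < m s"
      by blast
    from less.hyps[OF s1(6,5)] obtain segs s2 where s2:
      "exec n orc g (While e c) s1 (replicate (bcost e + 1) Tick @ call_segments segs) s2"
      "\<forall>seg\<in>set segs. Oracle_Call \<notin> set seg \<and> count_list seg Gradient_Call \<le> 1 \<and>
         count_list seg Tick \<le> B + (bcost e + 1)" "I s2" "\<not> bval s2 e"
      by blast
    have "exec n orc g (While e c) s
        (replicate (bcost e + 1) Tick @ call_segments ((seg @ replicate (bcost e + 1) Tick) # segs)) s2"
      using exec_WhileTrue[OF True s1(1) s2(1)] by simp
    moreover have "\<forall>seg'\<in>set ((seg @ replicate (bcost e + 1) Tick) # segs). Oracle_Call \<notin> set seg' \<and>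
        count_list seg' Gradient_Call \<le> 1 \<and> count_list seg' Tick \<le> B + (bcost e + 1)"
      using s1 s2(2) by (auto simp: count_list_replicate)
    ultimately show ?thesis using s2(3,4) by blast
  qed
qed

lemma count_calls_eq_replies:
  "exec n orc g c s t s' \<Longrightarrow> count_list t Oracle_Call + length (replies s) = length (replies s')"
  by (induction rule: exec.induct) (auto simp: count_list_replicate)

section \<open>From weighted replies to a distribution\<close>

text \<open>Several calls may return the same constraint. \<open>pmf_of_list\<close> adds up their
  weights, and grouping the calls by constraint turns expectations into sums over calls.\<close>

lemma weighted_replies_pmf:
  assumes w: "\<And>k. 0 \<le> w k" "(\<Sum>k<length rs. w k) = 1"
    and rs: "\<forall>r\<in>set rs. \<exists>j\<in>J. r = Some j"
  shows "\<exists>p. finite (set_pmf p) \<and> set_pmf p \<subseteq> J \<and>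
     (\<forall>j. pmf p j = (\<Sum>k | k < length rs \<and> rs ! k = Some j. w k)) \<and>
     (\<forall>\<phi>. (\<Sum>j\<in>set_pmf p. pmf p j * \<phi> j) = (\<Sum>k<length rs. w k * \<phi> (the (rs ! k))))"
proof -
  define xs where "xs = map (\<lambda>k. (the (rs ! k), w k)) [0..<length rs]"
  define p where "p = pmf_of_list xs"
  have "sum_list (map snd xs) = (\<Sum>k<length rs. w k)"
    by (simp add: xs_def o_def interv_sum_list_conv_sum_set_nat atLeast0LessThan)
  then have wf: "pmf_of_list_wf xs"
    unfolding pmf_of_list_wf_def using w by (auto simp: xs_def)
  have some: "rs ! k = Some (the (rs ! k))" "the (rs ! k) \<in> J" if "k < length rs" for k
    using rs nth_mem[OF that] by fastforce+
  have sub: "set_pmf p \<subseteq> (\<lambda>k. the (rs ! k)) ` {..<length rs}"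
    using set_pmf_of_list[OF wf] by (auto simp: p_def xs_def)
  have pmf: "pmf p j = (\<Sum>k | k < length rs \<and> rs ! k = Some j. w k)" for j
  proof -
    have "pmf p j = sum_list (map w (filter (\<lambda>k. the (rs ! k) = j) [0..<length rs]))"
      unfolding p_def pmf_pmf_of_list[OF wf] by (simp add: xs_def filter_map o_def)
    also have "\<dots> = sum w (set (filter (\<lambda>k. the (rs ! k) = j) [0..<length rs]))"
      by (rule sum_list_distinct_conv_sum_set) simp
    also have "set (filter (\<lambda>k. the (rs ! k) = j) [0..<length rs]) = {k. k < length rs \<and> rs ! k = Some j}"
      using some(1) by force
    finally show ?thesis .
  qed
  have "(\<Sum>j\<in>set_pmf p. pmf p j * \<phi> j) = (\<Sum>k<length rs. w k * \<phi> (the (rs ! k)))" for \<phi> :: "'a \<Rightarrow> real"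
  proof -
    let ?A = "(\<lambda>k. the (rs ! k)) ` {..<length rs}"
    \<comment> \<open>The support can be smaller than \<open>?A\<close>: constraints whose calls all
      have weight 0 are missing from it.\<close>
    have "(\<Sum>j\<in>set_pmf p. pmf p j * \<phi> j) = (\<Sum>j\<in>?A. pmf p j * \<phi> j)"
      using sub by (intro sum.mono_neutral_left) (auto simp: set_pmf_iff)
    also have "\<dots> = (\<Sum>j\<in>?A. \<Sum>k\<in>{k\<in>{..<length rs}. the (rs ! k) = j}. w k * \<phi> (the (rs ! k)))"
    proof (rule sum.cong[OF refl])
      fix j
      have "{k. k < length rs \<and> rs ! k = Some j} = {k\<in>{..<length rs}. the (rs ! k) = j}"
        using some(1) by force
      then show "pmf p j * \<phi> j = (\<Sum>k\<in>{k\<in>{..<length rs}. the (rs ! k) = j}. w k * \<phi> (the (rs ! k)))"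
        by (simp add: pmf sum_distrib_right)
    qed
    also have "\<dots> = (\<Sum>k<length rs. w k * \<phi> (the (rs ! k)))"
      by (rule sum.group) auto
    finally show ?thesis .
  qed
  moreover have "finite (set_pmf p)" "set_pmf p \<subseteq> J"
    using sub some(2) by (auto intro: finite_subset)
  ultimately show ?thesis using pmf by blast
qed

section \<open>The program\<close>

text \<open>
  Cells of the nat array 0: 0 \<open>n\<close>, 1 output flag, 2 loop counter, 3 number of calls, 4 number of
  finished rounds, 5 whether a projection is under way.  Cell 0 of the nat array 1: FAIL flag.
  Cells of the real array 0: 0 \<open>G\<close>, 1 \<open>H\<close>, 2 \<open>\<epsilon>\<close>, 3 and 4 ends of the bisection interval, 5 number of
  subintervals, 6 to 8 temporary, 9 step size.  Real arrays: 1 weights of the calls (later the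
  output), 2 iterate, 3 point to be projected, 4 gradient.
\<close>

definition prepare :: com where
  "prepare =
     RPut 1 (nvar 3) (RNat (NAdd (nvar 4) (NConst 1))) ;;
     Grad (nvar 3) 2 4 ;;
     rset 9 (RDiv (rnum 2) (RMul (rvar 1) (RNat (NAdd (nvar 4) (NConst 2))))) ;;
     for_loop 0 (rput_at 3 (RSub (rat 2) (RMul (rvar 9) (rat 4)))) ;;
     rset 3 (RSub (rnum 0) (RMul (rvar 9) (rvar 0))) ;;
     rset 4 (RMul (rvar 9) (rvar 0)) ;;
     rset 5 (rnum 1) ;; nset 5 (NConst 1)"

definition bisect :: com where
  "bisect =
     rset 7 (RDiv (RAdd (rvar 3) (rvar 4)) (rnum 2)) ;;
     com_pos_sum 7 6 ;;
     Cond (RLess (rvar 6) (rnum 1)) (rset 4 (rvar 7)) (rset 3 (rvar 7)) ;;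
     rset 5 (RAdd (rvar 5) (rvar 5))"

definition mix_loop :: com where
  "mix_loop = for_loop 0 (rput_at 2 (rnum 0) ;;
     Cond (RLess (rvar 4) (rat 3))
       (rput_at 2 (RMul (RSub (rnum 1) (rvar 8)) (RSub (rat 3) (rvar 4)))) Skip ;;
     Cond (RLess (rvar 3) (rat 3))
       (rput_at 2 (RAdd (rat 2) (RMul (rvar 8) (RSub (rat 3) (rvar 3))))) Skip)"

definition finish :: com where
  "finish =
     com_pos_sum 3 6 ;; com_pos_sum 4 7 ;;
     rset 8 (RDiv (RSub (rnum 1) (rvar 7)) (RSub (rvar 6) (rvar 7))) ;;
     mix_loop ;;
     nset 4 (NAdd (nvar 4) (NConst 1)) ;; nset 5 (NConst 0)"

text \<open>With \<open>2 ^ b\<close> in cell 5 this says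
  \<open>2 ^ b < 16 * G^2 / (H * \<epsilon>)\<close>, multiplied out by the positive number
  \<open>H * \<epsilon>\<close>.\<close>

definition coarse :: bexp where
  "coarse = RLess (RMul (rvar 5) (RMul (rvar 1) (rvar 2))) (RMul (rnum 16) (RMul (rvar 0) (rvar 0)))"

definition continue :: com where
  "continue =
     Cond (NLess (nvar 5) (NConst 1)) prepare Skip ;;
     bisect ;;
     Cond coarse Skip finish ;;
     nset 3 (NAdd (nvar 3) (NConst 1))"

text \<open>No FAIL so far, and fewer than \<open>4 * G^2 / (H * \<epsilon>) + 1\<close> finished
  rounds, again without division.\<close>

definition unfinished :: bexp where
  "unfinished = And (NLess (nvar 1) (NConst 1))
     (RLess (RMul (RNat (nvar 4)) (RMul (rvar 1) (rvar 2)))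
        (RAdd (RMul (rnum 4) (RMul (rvar 0) (rvar 0))) (RMul (rvar 1) (rvar 2))))"

definition body :: com where
  "body = Query 2 1 ;; Cond (NLess (NConst 0) (NGet 1 (NConst 0))) (nset 1 (NConst 1)) continue"

text \<open>The divisor is the sum of the weights 1, 2, ... of the finished rounds.\<close>

definition answer_code :: com where
  "answer_code = Cond (NLess (NConst 0) (nvar 1))
     (for_loop 0 (rput_at 1 (rat 2)))
     (for_loop 3 (rput_at 1 (RDiv (rat 1)
        (RDiv (RMul (RNat (nvar 4)) (RNat (NAdd (nvar 4) (NConst 1)))) (rnum 2)))))"

definition solver :: com where
  "solver = RPut 2 (NConst 0) (rnum 1) ;; While unfinished body ;; answer_code"

section \<open>Effect and cost of the pieces of the program\<close>

definition set_cell :: "nat \<Rightarrow> nat \<Rightarrow> real \<Rightarrow> 'j state \<Rightarrow> 'j state" where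
  "set_cell a k v s = s\<lparr>reals := (reals s)(a := (reals s a)(k := v))\<rparr>"

lemma steps_Grad:
  assumes "coords n (reals s a) \<in> unit_simplex n" "nval s e < length (replies s)"
    "replies s ! nval s e = Some j"
  shows "steps n orc g (Grad e a d) s (ncost e) 1 (set_array d n (g j (coords n (reals s a))) s)"
  unfolding steps_def set_array_def
  by (intro exI[of _ "replicate (ncost e) Tick @ [Gradient_Call]"] conjI exec_Grad[OF refl assms])
     (auto simp: count_list_replicate)

lemma steps_prepare:
  fixes s :: "'j state"
  assumes n: "nats s 0 0 = n" and x: "coords n (reals s 2) \<in> unit_simplex n"
    and k: "k = nats s 0 3" "k < length (replies s)" "replies s ! k = Some j"
    and \<eta>: "\<eta> = 2 / (reals s 0 1 * real (nats s 0 4 + 2))"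
  shows "steps n orc g prepare s (100 + n * 50) 1
    (set_nat 5 1 (set_real 5 1 (set_real 4 (\<eta> * reals s 0 0) (set_real 3 (- (\<eta> * reals s 0 0))
      (set_nat 2 n (set_array 3 n (\<lambda>i. reals s 2 i - \<eta> * g j (coords n (reals s 2)) i)
        (set_real 9 \<eta> (set_array 4 n (g j (coords n (reals s 2)))
          (set_cell 1 k (real (nats s 0 4 + 1)) s)))))))))"
proof -
  let ?v = "g j (coords n (reals s 2))"
  define s1 where "s1 = set_cell 1 k (real (nats s 0 4 + 1)) s"
  define s2 where "s2 = set_array 4 n ?v s1"
  define s3 where "s3 = set_real 9 \<eta> s2"
  define s4 where "s4 = set_nat 2 n (set_array 3 n (\<lambda>i. reals s 2 i - \<eta> * ?v i) s3)"
  define c where "c = (rset 3 (RSub (rnum 0) (RMul (rvar 9) (rvar 0))) ;;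
     rset 4 (RMul (rvar 9) (rvar 0)) ;; rset 5 (rnum 1) ;; nset 5 (NConst 1))"
  have "steps n orc g (RPut 1 (nvar 3) (RNat (NAdd (nvar 4) (NConst 1)))) s 10 0 s1"
    by (rule steps_runI)
       (auto simp: s1_def set_cell_def k(1))
  moreover have "steps n orc g (Grad (nvar 3) 2 4) s1 2 1 s2"
    using steps_Grad[of n s1 2 "nvar 3" j orc g 4] x k
    by (simp add: s1_def s2_def set_cell_def eval_nat_numeral)
  moreover have "steps n orc g (rset 9 (RDiv (rnum 2) (RMul (rvar 1) (RNat (NAdd (nvar 4) (NConst 2)))))) s2 20 0 s3"
    by (rule steps_runI)
       (auto simp: s1_def s2_def s3_def set_defs set_cell_def \<eta>)
  moreover have "steps n orc g (for_loop 0 (rput_at 3 (RSub (rat 2) (RMul (rvar 9) (rat 4))))) s3 (10 + n * 50) 0 s4"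
    unfolding s4_def
    by (rule steps_mono[OF steps_array])
       (auto simp: s1_def s2_def s3_def set_defs set_cell_def n)
  moreover have "steps n orc g c s4 40 0 (set_nat 5 1 (set_real 5 1
     (set_real 4 (\<eta> * reals s 0 0) (set_real 3 (- (\<eta> * reals s 0 0)) s4))))"
    by (rule steps_runI)
       (auto simp: s1_def s2_def s3_def s4_def set_defs set_cell_def c_def)
  ultimately have "steps n orc g prepare s (10 + (2 + (20 + (10 + n * 50 + 40)))) (0 + (1 + (0 + (0 + 0))))
    (set_nat 5 1 (set_real 5 1 (set_real 4 (\<eta> * reals s 0 0) (set_real 3 (- (\<eta> * reals s 0 0)) s4))))"
    unfolding prepare_def c_def[symmetric] by (intro steps_Seq)
  then show ?thesis unfolding s4_def s3_def s2_def s1_def by (elim steps_mono) auto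
qed

lemma steps_bisect:
  assumes n: "nats s 0 0 = n"
    and mid: "mid = (reals s 0 3 + reals s 0 4) / 2" and S: "S = pos_sum n (reals s 3) mid"
  shows "steps n orc g bisect s (100 + n * 50) 0
    (set_real 5 (2 * reals s 0 5) (set_real (if S < 1 then 4 else 3) mid
       (set_nat 2 n (set_real 6 S (set_real 7 mid s)))))"
proof -
  define s1 where "s1 = set_real 7 mid s"
  define s2 where "s2 = set_nat 2 n (set_real 6 S s1)"
  have "steps n orc g (rset 7 (RDiv (RAdd (rvar 3) (rvar 4)) (rnum 2))) s 20 0 s1"
    by (rule steps_runI) (auto simp: s1_def set_defs mid)
  moreover have "steps n orc g (com_pos_sum 7 6) s1 (20 + n * 50) 0 s2"
    using steps_pos_sum[of s1 n 7 6 n orc g] n S by (simp add: s1_def s2_def set_defs)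
  moreover have "steps n orc g (Cond (RLess (rvar 6) (rnum 1)) (rset 4 (rvar 7)) (rset 3 (rvar 7)) ;;
     rset 5 (RAdd (rvar 5) (rvar 5))) s2 50 0
     (set_real 5 (2 * reals s 0 5) (set_real (if S < 1 then 4 else 3) mid s2))"
    by (rule steps_runI) (auto simp: s1_def s2_def set_defs)
  ultimately have "steps n orc g bisect s (20 + (20 + n * 50 + 50)) (0 + (0 + 0))
     (set_real 5 (2 * reals s 0 5) (set_real (if S < 1 then 4 else 3) mid s2))"
    unfolding bisect_def by (intro steps_Seq)
  then show ?thesis unfolding s2_def s1_def by (elim steps_mono) auto
qed

lemma steps_mix_loop:
  assumes n: "nats s 0 0 = n"
  shows "steps n orc g mix_loop s (10 + n * 150) 0
    (set_nat 2 n (set_array 2 n (mix (reals s 3) (reals s 0 3) (reals s 0 4) (reals s 0 8)) s))"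
proof -
  define st where "st i = set_nat 2 i (set_array 2 i
     (mix (reals s 3) (reals s 0 3) (reals s 0 4) (reals s 0 8)) s)" for i
  let ?c = "rput_at 2 (rnum 0) ;;
     Cond (RLess (rvar 4) (rat 3))
       (rput_at 2 (RMul (RSub (rnum 1) (rvar 8)) (RSub (rat 3) (rvar 4)))) Skip ;;
     Cond (RLess (rvar 3) (rat 3))
       (rput_at 2 (RAdd (rat 2) (RMul (rvar 8) (RSub (rat 3) (rvar 3))))) Skip"
  have "steps n orc g mix_loop s (10 + n * (cost ?c + 20)) 0 (st n)"
    unfolding mix_loop_def
  proof (rule steps_for_loop)
    show "run (nset 2 (NConst 0)) s = st 0" by (simp add: st_def set_defs)
    show "run (?c ;; nset 2 (NAdd (nvar 2) (NConst 1))) (st i) = st (Suc i)" for i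
      by (auto simp: st_def set_defs mix_def max_def fun_eq_iff less_Suc_eq)
    show "nats (st i) 0 2 = i \<and> nats (st i) 0 0 = n" for i
      using n by (simp add: st_def set_defs)
  qed auto
  then show ?thesis unfolding st_def by (elim steps_mono) auto
qed

lemma steps_finish:
  assumes n: "nats s 0 0 = n"
    and A: "A = pos_sum n (reals s 3) (reals s 0 3)" and B: "B = pos_sum n (reals s 3) (reals s 0 4)"
  shows "steps n orc g finish s (150 + n * 250) 0
    (set_nat 5 0 (set_nat 4 (nats s 0 4 + 1)
      (set_nat 2 n (set_array 2 n (mix (reals s 3) (reals s 0 3) (reals s 0 4) ((1 - B) / (A - B)))
        (set_real 8 ((1 - B) / (A - B)) (set_nat 2 n (set_real 7 B (set_nat 2 n (set_real 6 A s)))))))))"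
proof -
  define s1 where "s1 = set_nat 2 n (set_real 6 A s)"
  define s2 where "s2 = set_nat 2 n (set_real 7 B s1)"
  define s3 where "s3 = set_real 8 ((1 - B) / (A - B)) s2"
  define s4 where "s4 = set_nat 2 n (set_array 2 n
    (mix (reals s 3) (reals s 0 3) (reals s 0 4) ((1 - B) / (A - B))) s3)"
  have "steps n orc g (com_pos_sum 3 6) s (20 + n * 50) 0 s1"
    using steps_pos_sum[of s n 3 6 n orc g] n A by (simp add: s1_def)
  moreover have "steps n orc g (com_pos_sum 4 7) s1 (20 + n * 50) 0 s2"
    using steps_pos_sum[of s1 n 4 7 n orc g] n B by (simp add: s1_def s2_def set_defs)
  moreover have "steps n orc g (rset 8 (RDiv (RSub (rnum 1) (rvar 7)) (RSub (rvar 6) (rvar 7)))) s2 20 0 s3"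
    by (rule steps_runI) (auto simp: s1_def s2_def s3_def set_defs)
  moreover have "steps n orc g mix_loop s3 (10 + n * 150) 0 s4"
    using steps_mix_loop[of s3 n orc g] n by (simp add: s1_def s2_def s3_def s4_def set_defs)
  moreover have "steps n orc g (nset 4 (NAdd (nvar 4) (NConst 1)) ;; nset 5 (NConst 0)) s4 20 0
     (set_nat 5 0 (set_nat 4 (nats s 0 4 + 1) s4))"
    by (rule steps_runI)
       (auto simp: s1_def s2_def s3_def s4_def set_defs)
  ultimately have "steps n orc g finish s
      ((20 + n * 50) + ((20 + n * 50) + (20 + (10 + n * 150 + 20)))) (0 + (0 + (0 + (0 + 0))))
     (set_nat 5 0 (set_nat 4 (nats s 0 4 + 1) s4))"
    unfolding finish_def by (intro steps_Seq)
  then show ?thesis unfolding s4_def s3_def s2_def s1_def by (elim steps_mono) auto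
qed

section \<open>Correctness\<close>

text \<open>The Hessian bound is represented by its consequence \<open>f\<close>, the quadratic
  lower bound on which the estimates below rest.\<close>

locale strongly_convex_program =
  fixes n :: nat and J :: "'j set" and f :: "'j \<Rightarrow> point \<Rightarrow> real" and g :: "'j \<Rightarrow> point \<Rightarrow> point"
    and G H \<epsilon> :: real and orc :: "nat \<Rightarrow> point \<Rightarrow> 'j option"
  assumes n: "1 \<le> n" and nonempty: "J \<noteq> {}" and H: "0 < H" and \<epsilon>: "0 < \<epsilon>"
    and f: "\<And>j x u. j \<in> J \<Longrightarrow> x \<in> unit_simplex n \<Longrightarrow> u \<in> unit_simplex n \<Longrightarrow>
      f j u \<ge> f j x + (\<Sum>i<n. g j x i * (u i - x i)) + H / 2 * dist2 n u x"
    and g: "\<And>j x. j \<in> J \<Longrightarrow> x \<in> unit_simplex n \<Longrightarrow> L2_set (g j x) {..<n} \<le> G"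
    and orc: "separation_oracle n J f \<epsilon> orc"
begin

definition X :: real where "X = G\<^sup>2 / (H * \<epsilon>)"

lemma X_nonneg: "0 \<le> X" using H \<epsilon> by (simp add: X_def)

lemma G_sq: "G\<^sup>2 = X * (H * \<epsilon>)" using H \<epsilon> by (simp add: X_def)

lemma abs_g_le: "j \<in> J \<Longrightarrow> x \<in> unit_simplex n \<Longrightarrow> i < n \<Longrightarrow> \<bar>g j x i\<bar> \<le> G"
  using g[of j x] member_le_L2_set[of "{..<n}" i "\<lambda>i. \<bar>g j x i\<bar>"]
  by (auto simp: L2_set_def)

text \<open>There is a constraint and a vertex of the simplex, so \<open>G\<close> bounds the
  modulus of some gradient entry.\<close>

lemma G_nonneg: "0 \<le> G"
proof -
  obtain j where "j \<in> J" using nonempty by blast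
  have "(\<lambda>i. if i = 0 then 1 else 0) \<in> unit_simplex n"
    using n by (auto simp: mem_unit_simplex)
  from abs_g_le[OF \<open>j \<in> J\<close> this, of 0] n show ?thesis by auto
qed

text \<open>\<open>fresh\<close> and \<open>busy\<close> bound from below the weighted sum of the functions collected so far, by a
  \<open>gain\<close> plus a multiple of the squared distance from \<open>u\<close> to the current iterate (\<open>fresh\<close>) or to the
  point that is being projected (\<open>busy\<close>).  In the second case a slack of \<open>\<epsilon> / 4\<close> per unit of weight is
  reserved for the projection error.\<close>

definition gain :: "real \<Rightarrow> real" where
  "gain r = 3 / 8 * \<epsilon> * r * (r + 1) - r * (G\<^sup>2 / H)"

abbreviation rounds :: "'j state \<Rightarrow> real" where "rounds s \<equiv> real (nats s 0 4)"

definition mass :: "'j state \<Rightarrow> real" where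
  "mass s = (\<Sum>k<length (replies s). reals s 1 k)"

definition total :: "'j state \<Rightarrow> point \<Rightarrow> real" where
  "total s u = (\<Sum>k<length (replies s). reals s 1 k * f (the (replies s ! k)) u)"

text \<open>Weights beyond the replies are 0, so a new reply does not count until
  \<open>prepare\<close> gives it a weight. FAIL is excluded from the list because the run stops at
  it.\<close>

definition wf_state :: "'j state \<Rightarrow> bool" where
  "wf_state s \<longleftrightarrow> nats s 0 0 = n \<and> nats s 0 1 = 0 \<and>
     reals s 0 0 = G \<and> reals s 0 1 = H \<and> reals s 0 2 = \<epsilon> \<and>
     coords n (reals s 2) \<in> unit_simplex n \<and>
     (\<forall>r\<in>set (replies s). \<exists>j\<in>J. r = Some j) \<and>
     (\<forall>k. 0 \<le> reals s 1 k) \<and> (\<forall>k\<ge>length (replies s). reals s 1 k = 0)"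

definition fresh :: "'j state \<Rightarrow> bool" where
  "fresh s \<longleftrightarrow> nats s 0 5 = 0 \<and> mass s = rounds s * (rounds s + 1) / 2 \<and>
     (\<forall>u\<in>unit_simplex n.
        gain (rounds s) + H * rounds s * (rounds s + 1) / 4 * dist2 n (reals s 2) u \<le> total s u)"

definition busy :: "nat \<Rightarrow> 'j state \<Rightarrow> bool" where
  "busy b s \<longleftrightarrow> nats s 0 5 = 1 \<and> reals s 0 5 = 2 ^ b \<and>
     mass s = (rounds s + 1) * (rounds s + 2) / 2 \<and>
     reals s 0 3 \<le> reals s 0 4 \<and>
     reals s 0 4 - reals s 0 3 = 4 * G / (H * (rounds s + 2) * 2 ^ b) \<and>
     1 \<le> pos_sum n (reals s 3) (reals s 0 3) \<and> pos_sum n (reals s 3) (reals s 0 4) \<le> 1 \<and>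
     (\<forall>u\<in>unit_simplex n.
        gain (rounds s + 1) + \<epsilon> / 4 * (rounds s + 1)
          + H * (rounds s + 1) * (rounds s + 2) / 4 * dist2 n (reals s 3) u \<le> total s u)"

lemma wf_cong:
  assumes "wf_state s"
    and "nats s' 0 0 = nats s 0 0" "nats s' 0 1 = nats s 0 1" "reals s' 0 0 = reals s 0 0"
      "reals s' 0 1 = reals s 0 1" "reals s' 0 2 = reals s 0 2" "reals s' 1 = reals s 1"
      "replies s' = replies s" "coords n (reals s' 2) \<in> unit_simplex n"
  shows "wf_state s'"
  using assms by (simp add: wf_state_def)

section \<open>Bisection, projection and new rounds\<close>

text \<open>The midpoint replaces the end on whose side its mass lies, so the interval still
  brackets the threshold and its length is halved.\<close>

lemma bisect_busy:
  assumes "wf_state s" "busy b s"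
  shows "\<exists>s'. steps n orc g bisect s (100 + n * 50) 0 s' \<and> wf_state s' \<and> busy (Suc b) s' \<and>
    replies s' = replies s \<and> nats s' 0 3 = nats s 0 3 \<and> nats s' 0 4 = nats s 0 4"
proof -
  define mid where "mid = (reals s 0 3 + reals s 0 4) / 2"
  define S where "S = pos_sum n (reals s 3) mid"
  let ?s = "set_real 5 (2 * reals s 0 5) (set_real (if S < 1 then 4 else 3) mid
       (set_nat 2 n (set_real 6 S (set_real 7 mid s))))"
  have "steps n orc g bisect s (100 + n * 50) 0 ?s"
    by (rule steps_bisect) (use assms(1) in \<open>auto simp: wf_state_def mid_def S_def\<close>)
  moreover have "wf_state ?s"
    by (rule wf_cong[OF assms(1)]) (use assms(1) in \<open>auto simp: set_defs wf_state_def\<close>)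
  moreover have "busy (Suc b) ?s"
  proof -
    have half: "4 * G / (H * (rounds s + 2) * 2 ^ Suc b) = (reals s 0 4 - reals s 0 3) / 2"
      using assms(2) by (simp add: busy_def)
    have "reals s 0 3 \<le> reals s 0 4" using assms(2) by (simp add: busy_def)
    then have "reals s 0 4 - mid = (reals s 0 4 - reals s 0 3) / 2" "mid - reals s 0 3 = (reals s 0 4 - reals s 0 3) / 2"
      "reals s 0 3 \<le> mid" "mid \<le> reals s 0 4"
      by (simp_all add: mid_def field_simps)
    then show ?thesis
      using assms(2) S_def unfolding busy_def
      by (simp add: set_defs mass_def total_def half del: power_Suc) (simp add: not_less)
  qed
  ultimately show ?thesis by (intro exI[of _ ?s]) (simp add: set_defs)
qed

text \<open>The weighted error of \<open>dist2_mix\<close> is \<open>2 * r * G / 2 ^ b\<close>. From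
  \<open>16 * X \<le> 2 ^ b\<close> and \<open>H \<le> 2 * G\<close> one gets
  \<open>8 * G \<le> \<epsilon> * 2 ^ b\<close>, which bounds it by
  \<open>\<epsilon> / 4 * r\<close>. In dimension 1 the projection is exact.\<close>

lemma projection_error:
  assumes r: "0 < r" and X: "16 * X \<le> 2 ^ b"
    and \<delta>: "hi - lo = 4 * G / (H * (r + 1) * 2 ^ b)" "lo \<le> hi"
    and x: "x = mix z lo hi c" "coords n x \<in> unit_simplex n" and c: "0 \<le> c" "c \<le> 1"
    and u: "u \<in> unit_simplex n"
  shows "H * r * (r + 1) / 4 * dist2 n x u \<le> H * r * (r + 1) / 4 * dist2 n z u + \<epsilon> / 4 * r"
proof (cases "n = 1")
  case True
  then have "coords n x = u" using x(2) u simplex_one_point by simp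
  then have "dist2 n x u = 0" by (metis (no_types, lifting) dist2_coords dist2_def diff_self power_zero_numeral sum.neutral)
  then show ?thesis using dist2_nonneg[of n z u] r H \<epsilon> by simp
next
  case False
  then have "2 \<le> n" using n by simp
  obtain j where "j \<in> J" using nonempty by blast
  have HG: "H \<le> 2 * G"
    using curvature_le_gradient[OF \<open>2 \<le> n\<close> f[OF \<open>j \<in> J\<close>] abs_g_le[OF \<open>j \<in> J\<close>]] .
  have sum: "(\<Sum>i<n. x i) = 1" using x(2) by (simp add: coords_in_simplex)
  have "8 * G \<le> \<epsilon> * 2 ^ b"
  proof -
    have "8 * G * H \<le> 16 * G\<^sup>2"
      using mult_left_mono[OF HG, of "8 * G"] G_nonneg by (simp add: power2_eq_square)
    also have "\<dots> = 16 * X * (H * \<epsilon>)" by (simp add: G_sq)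
    also have "\<dots> \<le> 2 ^ b * (H * \<epsilon>)" using X H \<epsilon> by (intro mult_right_mono) auto
    finally have "(8 * G) * H \<le> (\<epsilon> * 2 ^ b) * H" by (simp add: mult_ac)
    then show ?thesis using H by simp
  qed
  then have "2 * r * G / 2 ^ b \<le> \<epsilon> / 4 * r"
    using r by (simp add: field_simps)
  moreover have "H * r * (r + 1) / 4 * (2 * (hi - lo)) = 2 * r * G / 2 ^ b"
    using r H unfolding \<delta>(1) by (simp add: divide_simps)
  moreover have "H * r * (r + 1) / 4 * dist2 n x u \<le> H * r * (r + 1) / 4 * (dist2 n z u + 2 * (hi - lo))"
    using dist2_mix[OF u x(1) sum c \<delta>(2)] r H by (intro mult_left_mono) auto
  ultimately show ?thesis unfolding distrib_left by linarith
qed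

text \<open>The slack kept in \<open>busy\<close> pays for the projection error, which is all that
  separates it from the bound in \<open>fresh\<close>.\<close>

lemma finish_busy:
  assumes "wf_state s" "busy b s" "16 * X \<le> 2 ^ b"
  shows "\<exists>s'. steps n orc g finish s (150 + n * 250) 0 s' \<and> wf_state s' \<and> fresh s' \<and>
    replies s' = replies s \<and> nats s' 0 3 = nats s 0 3 \<and> nats s' 0 4 = Suc (nats s 0 4)"
proof -
  let ?lo = "reals s 0 3" and ?hi = "reals s 0 4" and ?z = "reals s 3"
  define A where "A = pos_sum n ?z ?lo"
  define B where "B = pos_sum n ?z ?hi"
  define c where "c = (1 - B) / (A - B)"
  define x where "x = mix ?z ?lo ?hi c"
  let ?s = "set_nat 5 0 (set_nat 4 (nats s 0 4 + 1)
      (set_nat 2 n (set_array 2 n x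
        (set_real 8 c (set_nat 2 n (set_real 7 B (set_nat 2 n (set_real 6 A s))))))))"
  have AB: "1 \<le> A" "B \<le> 1" using assms(2) by (simp_all add: busy_def A_def B_def)
  have c: "0 \<le> c" "c \<le> 1" and sum: "(\<Sum>i<n. x i) = 1"
    unfolding c_def x_def A_def B_def using mix_sum[of n ?z ?lo ?hi] AB by (simp_all add: A_def B_def)
  have x_in: "coords n x \<in> unit_simplex n"
    using sum c by (simp add: coords_in_simplex) (simp add: x_def mix_def)
  have coords_eq: "coords n (\<lambda>i. if i < n then x i else y i) = coords n x" for y
    by (auto simp: coords_def)
  have dist_eq: "dist2 n (\<lambda>i. if i < n then x i else y i) u = dist2 n x u" for y u
    by (simp add: dist2_def)
  have "steps n orc g finish s (150 + n * 250) 0 ?s"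
    unfolding x_def c_def
    by (rule steps_finish) (use assms(1) in \<open>auto simp: wf_state_def A_def B_def\<close>)
  moreover have "wf_state ?s"
    by (rule wf_cong[OF assms(1)]) (use x_in in \<open>auto simp: set_defs coords_eq\<close>)
  moreover have "fresh ?s"
  proof -
    have "gain (rounds s + 1) + H * (rounds s + 1) * (rounds s + 2) / 4 * dist2 n x u \<le> total s u"
      if u: "u \<in> unit_simplex n" for u
    proof -
      have "H * (rounds s + 1) * (rounds s + 1 + 1) / 4 * dist2 n x u
          \<le> H * (rounds s + 1) * (rounds s + 1 + 1) / 4 * dist2 n ?z u + \<epsilon> / 4 * (rounds s + 1)"
        by (rule projection_error[OF _ assms(3) _ _ x_def x_in c u])
           (use assms(2) in \<open>auto simp: busy_def add.assoc\<close>)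
      moreover have "gain (rounds s + 1) + \<epsilon> / 4 * (rounds s + 1)
          + H * (rounds s + 1) * (rounds s + 2) / 4 * dist2 n ?z u \<le> total s u"
        using assms(2) u by (simp add: busy_def)
      ultimately show ?thesis by (simp add: add.assoc)
    qed
    moreover have "mass s = (rounds s + 1) * (rounds s + 2) / 2" using assms(2) by (simp add: busy_def)
    ultimately show ?thesis
      unfolding fresh_def by (simp add: set_defs mass_def total_def dist_eq add.commute add.left_commute)
  qed
  ultimately show ?thesis by (intro exI[of _ ?s]) (simp add: set_defs)
qed

text \<open>Cell 3 is incremented only at the end of \<open>continue\<close>, so here it is the
  index of the call just answered, one less than the number of replies. As that call had weight 0,
  \<open>mass\<close> and \<open>total\<close> change by exactly its new contribution.\<close>

lemma prepare_fresh:
  assumes wf: "wf_state s" and fresh: "fresh s" and k: "length (replies s) = Suc (nats s 0 3)"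
    and w: "reals s 1 (nats s 0 3) = 0"
    and j: "replies s ! nats s 0 3 = Some j" "f j (coords n (reals s 2)) > \<epsilon>"
  shows "\<exists>s'. steps n orc g prepare s (100 + n * 50) 1 s' \<and> wf_state s' \<and> busy 0 s' \<and>
    replies s' = replies s \<and> nats s' 0 3 = nats s 0 3 \<and> nats s' 0 4 = nats s 0 4"
proof -
  let ?k = "nats s 0 3" and ?x = "reals s 2"
  define r where "r = rounds s + 1"
  define \<eta> where "\<eta> = 2 / (H * (r + 1))"
  define v where "v = g j (coords n ?x)"
  define z where "z = (\<lambda>i. ?x i - \<eta> * v i)"
  let ?s = "set_nat 5 1 (set_real 5 1 (set_real 4 (\<eta> * G) (set_real 3 (- (\<eta> * G))
      (set_nat 2 n (set_array 3 n z (set_real 9 \<eta> (set_array 4 n v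
          (set_cell 1 ?k r s))))))))"
  have x: "coords n ?x \<in> unit_simplex n" and G: "reals s 0 0 = G" and HH: "reals s 0 1 = H"
    using wf by (simp_all add: wf_state_def)
  have r0: "0 < r" by (simp add: r_def)
  have \<eta>0: "0 < \<eta>" using H r0 by (simp add: \<eta>_def)
  have jJ: "j \<in> J" using wf j(1) k nth_mem[of ?k "replies s"] by (auto simp: wf_state_def)
  have "steps n orc g prepare s (100 + n * 50) 1 ?s"
    using steps_prepare[of s n ?k j \<eta> orc g] wf x j(1) k
    by (simp add: wf_state_def r_def \<eta>_def v_def z_def add.commute)
  moreover have "wf_state ?s"
    using wf k r0 by (auto simp: wf_state_def set_defs set_cell_def)
  moreover have "busy 0 ?s"
  proof -
    have mass: "mass ?s = mass s + r"
      using k w by (simp add: mass_def set_defs set_cell_def)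
    have total: "total ?s u = total s u + r * f j u" for u
      using k w j(1) by (simp add: total_def set_defs set_cell_def)
    have proj: "1 \<le> pos_sum n z (- (\<eta> * G))" "pos_sum n z (\<eta> * G) \<le> 1"
      unfolding z_def using abs_g_le[OF jJ x] \<eta>0
      by (auto intro!: pos_sum_gradient_step[OF x] simp: abs_mult v_def)
    have pos_eq: "pos_sum n (\<lambda>i. if i < n then z i else y i) \<theta> = pos_sum n z \<theta>" for y \<theta>
      by (simp add: pos_sum_def)
    have dist_eq: "dist2 n (\<lambda>i. if i < n then z i else y i) u = dist2 n z u" for y u
      by (simp add: dist2_def)
    have dist_z: "dist2 n (\<lambda>i. coords n ?x i - \<eta> * v i) u = dist2 n z u" for u
      by (simp add: dist2_def z_def coords_def)
    have bound: "gain r + \<epsilon> / 4 * r + H * r * (r + 1) / 4 * dist2 n z u \<le> total s u + r * f j u"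
      if u: "u \<in> unit_simplex n" for u
    proof -
      have "r * f j u \<ge> r * \<epsilon> + H * r * (r + 1) / 4 * dist2 n z u
           - H * (r - 1) * r / 4 * dist2 n ?x u - G\<^sup>2 / H"
        using gradient_step_bound[OF r0 H f[OF jJ x u] _ g[OF jJ x], of \<epsilon>] j(2)
        by (simp add: dist2_coords dist_z v_def[symmetric] \<eta>_def[symmetric])
      moreover have "gain (r - 1) + H * (r - 1) * r / 4 * dist2 n ?x u \<le> total s u"
        using fresh u by (simp add: fresh_def r_def)
      \<comment> \<open>Of the new term \<open>r * \<epsilon>\<close>, three quarters enter the gain
        and one quarter becomes the slack for the projection.\<close>
      moreover have "gain r = gain (r - 1) + 3 / 4 * \<epsilon> * r - G\<^sup>2 / H"
        by (simp add: gain_def algebra_simps diff_divide_distrib add_divide_distrib)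
      ultimately show ?thesis by (simp add: algebra_simps)
    qed
    have "mass s = (r - 1) * r / 2" using fresh by (simp add: fresh_def r_def)
    then have mass': "mass ?s = r * (r + 1) / 2" unfolding mass by (simp add: algebra_simps)
    have "\<eta> * G - - (\<eta> * G) = 4 * G / (H * (r + 1))" by (simp add: \<eta>_def)
    moreover have "rounds ?s = rounds s" by (simp add: set_defs set_cell_def)
    moreover have "- (\<eta> * G) \<le> \<eta> * G" using \<eta>0 G_nonneg by (simp add: order.trans[of _ 0])
    ultimately show ?thesis
      unfolding busy_def mass' total using proj bound
      by (simp add: set_defs set_cell_def pos_eq dist_eq r_def add.assoc)
  qed
  ultimately show ?thesis by (intro exI[of _ ?s]) (simp add: set_defs set_cell_def)
qed


text \<open>Determines the \<open>K\<close> at which \<open>coarse\<close> first fails after a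
  bisection step; a round then takes exactly \<open>K\<close> calls.\<close>

definition enough :: "nat \<Rightarrow> bool" where
  "enough K \<longleftrightarrow> 1 \<le> K \<and> 16 * X \<le> 2 ^ K \<and> (\<forall>b. 1 \<le> b \<and> b < K \<longrightarrow> 2 ^ b < 16 * X)"

text \<open>\<open>b\<close> counts the bisection steps done in the current round.\<close>

definition stage :: "nat \<Rightarrow> 'j state \<Rightarrow> bool" where
  "stage b s \<longleftrightarrow> b = 0 \<and> fresh s \<or> busy b s"

text \<open>Each pass makes one bisection step. The first of a round also includes
  \<open>prepare\<close>, the \<open>K\<close>-th also \<open>finish\<close>; for
  \<open>K = 1\<close> all three fall between the same two calls, which the bounds allow
  for.\<close>

lemma continue_stage:
  assumes wf: "wf_state s" and k: "length (replies s) = Suc (nats s 0 3)"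
    and w: "reals s 1 (nats s 0 3) = 0"
    and j: "replies s ! nats s 0 3 = Some j" "f j (coords n (reals s 2)) > \<epsilon>"
    and K: "enough K" and b: "b < K" "stage b s"
  shows "\<exists>s'. steps n orc g continue s (400 + n * 350) 1 s' \<and> wf_state s' \<and>
    replies s' = replies s \<and> nats s' 0 3 = Suc (nats s 0 3) \<and>
    (nats s' 0 4 = nats s 0 4 \<and> Suc b < K \<and> busy (Suc b) s' \<or>
     nats s' 0 4 = Suc (nats s 0 4) \<and> Suc b = K \<and> fresh s')"
proof -
  obtain s1 where s1: "steps n orc g (Cond (NLess (nvar 5) (NConst 1)) prepare Skip) s (110 + n * 50) 1 s1"
    "wf_state s1" "busy b s1" "replies s1 = replies s" "nats s1 0 3 = nats s 0 3" "nats s1 0 4 = nats s 0 4"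
  proof (cases "busy b s")
    case True
    have "steps n orc g (if bval s (NLess (nvar 5) (NConst 1)) then prepare else Skip) s 1 0 s"
      using True by (auto simp: busy_def intro: steps_runI)
    from steps_Cond[OF this] have "steps n orc g (Cond (NLess (nvar 5) (NConst 1)) prepare Skip) s (110 + n * 50) 1 s"
      by (rule steps_mono) auto
    with that wf True show ?thesis by blast
  next
    case False
    with b have "b = 0" "fresh s" by (auto simp: stage_def)
    from prepare_fresh[OF wf \<open>fresh s\<close> k w j] obtain s1 where s1:
      "steps n orc g prepare s (100 + n * 50) 1 s1" "wf_state s1" "busy 0 s1" "replies s1 = replies s"
      "nats s1 0 3 = nats s 0 3" "nats s1 0 4 = nats s 0 4" by blast
    have "steps n orc g (if bval s (NLess (nvar 5) (NConst 1)) then prepare else Skip) s (100 + n * 50) 1 s1"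
      using s1 \<open>fresh s\<close> by (simp add: fresh_def)
    from steps_Cond[OF this] have "steps n orc g (Cond (NLess (nvar 5) (NConst 1)) prepare Skip) s (110 + n * 50) 1 s1"
      by (rule steps_mono) auto
    with that s1 \<open>b = 0\<close> show ?thesis by blast
  qed
  from bisect_busy[OF s1(2,3)] obtain s2 where s2: "steps n orc g bisect s1 (100 + n * 50) 0 s2"
    "wf_state s2" "busy (Suc b) s2" "replies s2 = replies s" "nats s2 0 3 = nats s 0 3" "nats s2 0 4 = nats s 0 4"
    using s1 by auto
  have "bval s2 coarse \<longleftrightarrow> 2 ^ Suc b * (H * \<epsilon>) < 16 * X * (H * \<epsilon>)"
    using s2(2,3) G_sq by (simp add: coarse_def wf_state_def busy_def power2_eq_square mult.assoc)
  then have coarse: "bval s2 coarse \<longleftrightarrow> 2 ^ Suc b < 16 * X"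
    unfolding mult_less_cancel_right_pos[OF mult_pos_pos[OF H \<epsilon>]] .
  obtain s3 where s3: "steps n orc g (Cond coarse Skip finish) s2 (170 + n * 250) 0 s3"
    "wf_state s3" "replies s3 = replies s" "nats s3 0 3 = nats s 0 3"
    "nats s3 0 4 = nats s 0 4 \<and> Suc b < K \<and> busy (Suc b) s3 \<or>
     nats s3 0 4 = Suc (nats s 0 4) \<and> Suc b = K \<and> fresh s3"
  proof (cases "bval s2 coarse")
    case True
    have "steps n orc g (if bval s2 coarse then Skip else finish) s2 1 0 s2"
      using True by (auto intro: steps_runI)
    from steps_Cond[OF this] have "steps n orc g (Cond coarse Skip finish) s2 (170 + n * 250) 0 s2"
      by (rule steps_mono) (auto simp: coarse_def)
    moreover have "Suc b < K"
      using True K b(1) unfolding coarse enough_def by (metis Suc_lessI not_le)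
    ultimately show ?thesis using that s2 by blast
  next
    case False
    then have "16 * X \<le> 2 ^ Suc b" unfolding coarse by simp
    from finish_busy[OF s2(2,3) this] obtain s3 where s3:
      "steps n orc g finish s2 (150 + n * 250) 0 s3" "wf_state s3" "fresh s3"
      "replies s3 = replies s" "nats s3 0 3 = nats s 0 3" "nats s3 0 4 = Suc (nats s 0 4)"
      using s2 by auto
    have "steps n orc g (if bval s2 coarse then Skip else finish) s2 (150 + n * 250) 0 s3"
      using False s3 by simp
    from steps_Cond[OF this] have "steps n orc g (Cond coarse Skip finish) s2 (170 + n * 250) 0 s3"
      by (rule steps_mono) (auto simp: coarse_def)
    moreover have "Suc b = K"
      using \<open>16 * X \<le> 2 ^ Suc b\<close> K b(1) unfolding enough_def
      by (metis Suc_lessI le_add1 not_le plus_1_eq_Suc)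
    ultimately show ?thesis using that s3 by blast
  qed
  define s4 where "s4 = set_nat 3 (Suc (nats s 0 3)) s3"
  have "steps n orc g (nset 3 (NAdd (nvar 3) (NConst 1))) s3 20 0 s4"
    by (rule steps_runI) (auto simp: s4_def set_defs s3(4))
  from steps_Seq[OF s1(1) steps_Seq[OF s2(1) steps_Seq[OF s3(1) this]]]
  have "steps n orc g continue s (400 + n * 350) 1 s4"
    unfolding continue_def by (rule steps_mono) auto
  moreover have "wf_state s4"
    by (rule wf_cong[OF s3(2)]) (use s3(2) in \<open>auto simp: s4_def set_defs wf_state_def\<close>)
  moreover have "fresh s4 = fresh s3" "busy (Suc b) s4 = busy (Suc b) s3"
    by (simp_all add: s4_def set_defs fresh_def busy_def mass_def total_def)
  ultimately show ?thesis
    using s3(3-5) by (intro exI[of _ s4]) (auto simp: s4_def set_defs)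
qed

section \<open>The invariant of the main loop\<close>

text \<open>A finished round has used \<open>K\<close> calls, the current one \<open>b\<close>.
  Rounds start only below \<open>4 * X + 1\<close>, so a state with at least that many finished
  rounds is fresh; the certificate is read off such a state.\<close>

definition running :: "nat \<Rightarrow> 'j state \<Rightarrow> bool" where
  "running K s \<longleftrightarrow> wf_state s \<and> nats s 0 3 = length (replies s) \<and> rounds s < 4 * X + 2 \<and>
     (\<exists>b<K. length (replies s) = nats s 0 4 * K + b \<and> stage b s \<and> (rounds s < 4 * X + 1 \<or> b = 0 \<and> fresh s))"

definition solved :: "'j state \<Rightarrow> bool" where
  "solved s \<longleftrightarrow> replies s \<noteq> [] \<and> nats s 0 0 = n \<and> nats s 0 1 = 1 \<and> coords n (reals s 2) \<in> unit_simplex n \<and>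
     (\<forall>j\<in>J. f j (coords n (reals s 2)) \<le> \<epsilon>)"

definition invariant :: "nat \<Rightarrow> 'j state \<Rightarrow> bool" where
  "invariant K s \<longleftrightarrow> (running K s \<or> solved s) \<and> real (length (replies s)) \<le> (4 * X + 2) * real K"

lemma unfinished_iff:
  assumes "wf_state s"
  shows "bval s unfinished \<longleftrightarrow> rounds s < 4 * X + 1"
proof -
  have "bval s unfinished \<longleftrightarrow> rounds s * (H * \<epsilon>) < (4 * X + 1) * (H * \<epsilon>)"
    using assms G_sq by (simp add: unfinished_def wf_state_def power2_eq_square algebra_simps)
  then show ?thesis unfolding mult_less_cancel_right_pos[OF mult_pos_pos[OF H \<epsilon>]] .
qed

lemma body_invariant:
  assumes I: "invariant K s" and go: "bval s unfinished" and K: "enough K"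
  shows "\<exists>seg s'. exec n orc g body s (Oracle_Call # seg) s' \<and> Oracle_Call \<notin> set seg \<and>
     count_list seg Gradient_Call \<le> 1 \<and> count_list seg Tick \<le> 410 + n * 350 \<and> invariant K s' \<and>
     length (replies s') = Suc (length (replies s)) \<and> length (replies s) < nat \<lfloor>(4 * X + 2) * real K\<rfloor>"
proof -
  from I go have run: "running K s" by (auto simp: invariant_def solved_def unfinished_def)
  then obtain b where wf: "wf_state s" and k: "nats s 0 3 = length (replies s)"
    and b: "b < K" "length (replies s) = nats s 0 4 * K + b" "stage b s"
    by (auto simp: running_def)
  have r: "rounds s < 4 * X + 1" using go unfinished_iff[OF wf] by simp
  \<comment> \<open>Because \<open>b < K\<close>, the coming call still belongs to the round after
    the finished ones.\<close>
  have "real (Suc (length (replies s))) \<le> real ((nats s 0 4 + 1) * K)"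
    using b by (simp only: of_nat_le_iff) simp
  also have "\<dots> = (rounds s + 1) * real K" by (simp add: algebra_simps)
  also have "\<dots> \<le> (4 * X + 2) * real K" using r by (intro mult_right_mono) auto
  finally have len: "real (Suc (length (replies s))) \<le> (4 * X + 2) * real K" .
  then have "int (Suc (length (replies s))) \<le> \<lfloor>(4 * X + 2) * real K\<rfloor>"
    by (simp add: le_floor_iff)
  then have fuel: "length (replies s) < nat \<lfloor>(4 * X + 2) * real K\<rfloor>" by linarith
  let ?x = "coords n (reals s 2)" and ?L = "length (replies s)"
  have x: "?x \<in> unit_simplex n" using wf by (simp add: wf_state_def)
  define a where "a = orc ?L ?x"
  define s1 where "s1 = s\<lparr>replies := replies s @ [a],
     nats := (nats s)(1 := (nats s 1)(0 := (if a = None then 1 else 0)))\<rparr>"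
  have query: "exec n orc g (Query 2 1) s [Oracle_Call] s1"
    unfolding s1_def a_def by (rule exec_Query[OF refl x refl])
  let ?c = "Cond (NLess (NConst 0) (NGet 1 (NConst 0))) (nset 1 (NConst 1)) continue"
  have reply: "case a of Some j \<Rightarrow> j \<in> J \<and> f j ?x > \<epsilon> | None \<Rightarrow> \<forall>j\<in>J. f j ?x \<le> \<epsilon>"
    using orc x unfolding separation_oracle_def a_def by blast
  obtain s' where s': "steps n orc g ?c s1 (410 + n * 350) 1 s'" "invariant K s'" "length (replies s') = Suc ?L"
  proof (cases a)
    case None
    let ?s = "set_nat 1 1 s1"
    have "steps n orc g (if bval s1 (NLess (NConst 0) (NGet 1 (NConst 0))) then nset 1 (NConst 1) else continue) s1 10 0 ?s"
      using None by (auto simp: s1_def set_defs intro: steps_runI)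
    from steps_Cond[OF this] have "steps n orc g ?c s1 (410 + n * 350) 1 ?s"
      by (rule steps_mono) auto
    moreover have "solved ?s"
      using wf reply None by (simp add: solved_def s1_def set_defs wf_state_def)
    moreover have "length (replies ?s) = Suc ?L" by (simp add: s1_def set_defs)
    ultimately show ?thesis using that len by (simp add: invariant_def)
  next
    case (Some j)
    have j: "j \<in> J" "f j ?x > \<epsilon>" using reply Some by auto
    have w: "reals s 1 ?L = 0" using wf by (simp add: wf_state_def)
    have wf1: "wf_state s1"
      using wf Some j(1) by (auto simp: wf_state_def s1_def)
    \<comment> \<open>The appended reply has weight 0.\<close>
    have "mass s1 = mass s" "total s1 u = total s u" for u
      using w by (simp_all add: mass_def total_def s1_def nth_append)
    then have "stage b s1" using b(3) by (simp add: stage_def fresh_def busy_def s1_def)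
    then have "\<exists>s'. steps n orc g continue s1 (400 + n * 350) 1 s' \<and> wf_state s' \<and>
      replies s' = replies s1 \<and> nats s' 0 3 = Suc (nats s1 0 3) \<and>
      (nats s' 0 4 = nats s1 0 4 \<and> Suc b < K \<and> busy (Suc b) s' \<or>
       nats s' 0 4 = Suc (nats s1 0 4) \<and> Suc b = K \<and> fresh s')"
      by (intro continue_stage[OF wf1 _ _ _ _ K b(1), of j]) (use k w Some j(2) in \<open>auto simp: s1_def\<close>)
    then obtain s' where s': "steps n orc g continue s1 (400 + n * 350) 1 s'" "wf_state s'"
      "replies s' = replies s1" "nats s' 0 3 = Suc (nats s1 0 3)"
      "nats s' 0 4 = nats s1 0 4 \<and> Suc b < K \<and> busy (Suc b) s' \<or>
       nats s' 0 4 = Suc (nats s1 0 4) \<and> Suc b = K \<and> fresh s'"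
      by blast
    have "steps n orc g (if bval s1 (NLess (NConst 0) (NGet 1 (NConst 0))) then nset 1 (NConst 1) else continue) s1 (400 + n * 350) 1 s'"
      using Some s'(1) by (simp add: s1_def)
    from steps_Cond[OF this] have "steps n orc g ?c s1 (410 + n * 350) 1 s'"
      by (rule steps_mono) auto
    moreover have len': "length (replies s') = Suc ?L" using s'(3) by (simp add: s1_def)
    moreover have "running K s'"
      using s'(5)
    proof
      assume A: "nats s' 0 4 = nats s1 0 4 \<and> Suc b < K \<and> busy (Suc b) s'"
      then show ?thesis
        using s'(2,4) len' k b(2) r unfolding running_def stage_def
        by (auto simp: s1_def intro!: exI[of _ "Suc b"])
    next
      assume A: "nats s' 0 4 = Suc (nats s1 0 4) \<and> Suc b = K \<and> fresh s'"
      then show ?thesis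
        using s'(2,4) len' k b(1,2) r unfolding running_def stage_def
        by (auto simp: s1_def intro!: exI[of _ 0])
    qed
    ultimately show ?thesis using that len by (simp add: invariant_def)
  qed
  from s'(1) obtain seg where seg: "exec n orc g ?c s1 seg s'" "Oracle_Call \<notin> set seg"
    "count_list seg Gradient_Call \<le> 1" "count_list seg Tick \<le> 410 + n * 350"
    unfolding steps_def by blast
  have "exec n orc g body s (Oracle_Call # seg) s'"
    using exec_Seq[OF query seg(1)] by (simp add: body_def)
  then show ?thesis using seg s'(2,3) fuel by blast
qed


section \<open>The answer and the whole run\<close>

text \<open>\<open>gain t\<close> is \<open>t * \<epsilon>\<close> times
  \<open>3 / 8 * (t + 1) - X\<close>, and for \<open>t \<ge> 4 * X + 1\<close> the last factor is at
  least \<open>X / 2 + 3 / 4\<close>.\<close>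

lemma gain_pos:
  assumes "4 * X + 1 \<le> t"
  shows "0 < gain t"
proof -
  have "gain t = t * \<epsilon> * (3 / 8 * (t + 1) - X)"
    using H by (simp add: gain_def G_sq algebra_simps)
  moreover have "0 < 3 / 8 * (t + 1) - X" "0 < t" using assms X_nonneg by simp_all
  ultimately show ?thesis using \<epsilon> by simp
qed

lemma answer_solved:
  assumes "solved s"
  shows "\<exists>s' out. steps n orc g answer_code s (100 + n * 100) 0 s' \<and> outputs n s' out \<and>
    approximate_solution n J f \<epsilon> out"
proof -
  let ?l = "for_loop 0 (rput_at 1 (rat 2))" and ?x = "coords n (reals s 2)"
  let ?s = "set_nat 2 n (set_array 1 n (reals s 2) s)"
  have "steps n orc g ?l s (10 + n * (rcost (rat 2) + 30)) 0 ?s"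
    by (rule steps_array) (use assms in \<open>auto simp: solved_def set_defs\<close>)
  then have "steps n orc g (if bval s (NLess (NConst 0) (nvar 1)) then ?l else c) s (10 + n * 40) 0 ?s" for c
    using assms by (auto simp: solved_def elim!: steps_mono)
  from steps_Cond[OF this] have "steps n orc g answer_code s (100 + n * 100) 0 ?s"
    unfolding answer_code_def by (rule steps_mono) auto
  moreover have "outputs n ?s (Point ?x)"
    using assms by (auto simp: solved_def set_defs coords_def)
  moreover have "approximate_solution n J f \<epsilon> (Point ?x)"
    using assms by (simp add: solved_def)
  ultimately show ?thesis by blast
qed

text \<open>Dropping the nonnegative distance term leaves a weighted sum of constraints of at least
  \<open>gain t > 0\<close> on the whole simplex; division by the total weight gives the
  certificate.\<close>

lemma answer_running:
  assumes run: "running K s" and stop: "\<not> bval s unfinished"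
  shows "\<exists>s' out. steps n orc g answer_code s (100 + length (replies s) * 100) 0 s' \<and> outputs n s' out \<and>
    approximate_solution n J f \<epsilon> out"
proof -
  let ?L = "length (replies s)"
  define t where "t = rounds s"
  define W where "W = t * (t + 1) / 2"
  define w where "w k = (if k < ?L then reals s 1 k / W else 0)" for k
  have wf: "wf_state s" and k: "nats s 0 3 = ?L" using run by (auto simp: running_def)
  have t: "4 * X + 1 \<le> t" using stop unfinished_iff[OF wf] by (simp add: t_def)
  then have fresh: "fresh s" using run by (auto simp: running_def t_def)
  have "0 < t" using t X_nonneg by simp
  then have W: "0 < W" by (simp add: W_def)
  let ?e = "RDiv (rat 1) (RDiv (RMul (RNat (nvar 4)) (RNat (NAdd (nvar 4) (NConst 1)))) (rnum 2))"
  let ?l = "for_loop 3 (rput_at 1 ?e)"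
  let ?s = "set_nat 2 ?L (set_array 1 ?L w s)"
  have "steps n orc g ?l s (10 + ?L * (rcost ?e + 30)) 0 ?s"
    by (rule steps_array) (auto simp: k w_def W_def t_def set_defs)
  then have "steps n orc g (if bval s (NLess (NConst 0) (nvar 1)) then c else ?l) s (10 + ?L * 60) 0 ?s" for c
    using wf by (auto simp: wf_state_def elim!: steps_mono)
  from steps_Cond[OF this] have "steps n orc g answer_code s (100 + ?L * 100) 0 ?s"
    unfolding answer_code_def by (rule steps_mono) auto
  moreover have "\<exists>p. finite (set_pmf p) \<and> set_pmf p \<subseteq> J \<and>
     (\<forall>j. pmf p j = (\<Sum>k | k < ?L \<and> replies s ! k = Some j. w k)) \<and>
     (\<forall>\<phi>. (\<Sum>j\<in>set_pmf p. pmf p j * \<phi> j) = (\<Sum>k<?L. w k * \<phi> (the (replies s ! k))))"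
  proof (rule weighted_replies_pmf)
    show "0 \<le> w k" for k using wf W by (simp add: w_def wf_state_def)
    have "(\<Sum>k<?L. w k) = mass s / W" by (simp add: w_def mass_def sum_divide_distrib)
    also have "mass s = W" using fresh by (simp add: fresh_def W_def t_def)
    finally show "(\<Sum>k<?L. w k) = 1" using W by simp
    show "\<forall>r\<in>set (replies s). \<exists>j\<in>J. r = Some j" using wf by (simp add: wf_state_def)
  qed
  then obtain p where p: "finite (set_pmf p)" "set_pmf p \<subseteq> J"
     "\<And>j. pmf p j = (\<Sum>k | k < ?L \<and> replies s ! k = Some j. w k)"
     "\<And>\<phi>. (\<Sum>j\<in>set_pmf p. pmf p j * \<phi> j) = (\<Sum>k<?L. w k * \<phi> (the (replies s ! k)))"
    by blast
  have "outputs n ?s (Infeasible p)"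
    using wf p(3) by (auto simp: wf_state_def set_defs intro!: sum.cong)
  moreover have "approximate_solution n J f \<epsilon> (Infeasible p)"
  proof -
    have "0 < (\<Sum>j\<in>set_pmf p. pmf p j * f j u)" if u: "u \<in> unit_simplex n" for u
    proof -
      have "gain t + H * t * (t + 1) / 4 * dist2 n (reals s 2) u \<le> total s u"
        using fresh u by (simp add: fresh_def t_def)
      moreover have "0 \<le> H * t * (t + 1) / 4 * dist2 n (reals s 2) u"
        using H \<open>0 < t\<close> dist2_nonneg by simp
      ultimately have "0 < total s u" using gain_pos[OF t] by linarith
      moreover have "(\<Sum>k<?L. w k * f (the (replies s ! k)) u) = total s u / W"
        by (simp add: w_def total_def sum_divide_distrib)
      ultimately show ?thesis using W by (simp add: p(4))
    qed
    then show ?thesis using p(1,2) by (simp add: infeasibility_certificate_def)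
  qed
  ultimately show ?thesis by blast
qed

lemma solver_correct:
  assumes K: "enough K"
  shows "\<exists>t s out. exec n orc g solver (initial_state n G H \<epsilon>) t s \<and>
     outputs n s out \<and> approximate_solution n J f \<epsilon> out \<and>
     real (count_list t Oracle_Call) \<le> (4 * X + 2) * real K \<and> work_bounded 1000 n t"
proof -
  let ?i = "initial_state n G H \<epsilon> :: 'j state"
  define s0 where "s0 = set_cell 2 0 1 ?i"
  have start: "exec n orc g (RPut 2 (NConst 0) (rnum 1)) ?i (replicate 4 Tick) s0"
    using exec_RPut[of n orc g 2 "NConst 0" "rnum 1" ?i]
    by (simp add: s0_def set_cell_def eval_nat_numeral)
  have "invariant K s0"
  proof -
    have "coords n (reals s0 2) \<in> unit_simplex n"
      using n by (auto simp: s0_def set_cell_def initial_state_def coords_in_simplex)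
    then have "wf_state s0"
      by (auto simp: wf_state_def s0_def set_cell_def initial_state_def)
    moreover have "fresh s0"
      by (simp add: fresh_def s0_def set_cell_def initial_state_def mass_def total_def gain_def)
    moreover have "0 < K" using K by (simp add: enough_def)
    ultimately show ?thesis using X_nonneg
      by (auto simp: invariant_def running_def stage_def s0_def set_cell_def initial_state_def)
  qed
  define m :: "'j state \<Rightarrow> nat" where "m s = nat \<lfloor>(4 * X + 2) * real K\<rfloor> - length (replies s)" for s
  have step: "\<exists>seg s'. exec n orc g body s (Oracle_Call # seg) s' \<and>
      Oracle_Call \<notin> set seg \<and> count_list seg Gradient_Call \<le> 1 \<and> count_list seg Tick \<le> 410 + n * 350 \<and>
      invariant K s' \<and> m s' < m s" if "invariant K s" "bval s unfinished" for s
    using body_invariant[OF that K] unfolding m_def by (metis diff_less_mono2 lessI)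
  from exec_While_calls[of "invariant K" unfinished n orc g body, OF step \<open>invariant K s0\<close>]
  obtain segs s1 where s1: "exec n orc g (While unfinished body) s0
      (replicate (bcost unfinished + 1) Tick @ call_segments segs) s1"
    "\<forall>seg\<in>set segs. Oracle_Call \<notin> set seg \<and> count_list seg Gradient_Call \<le> 1 \<and>
         count_list seg Tick \<le> (410 + n * 350) + (bcost unfinished + 1)"
    "invariant K s1" "\<not> bval s1 unfinished"
    by blast
  have "count_list (call_segments xs) Oracle_Call = length xs" if "\<forall>seg\<in>set xs. Oracle_Call \<notin> set seg" for xs
    using that by (induction xs) (auto simp: count_list_0_iff[THEN iffD2])
  then have calls: "length (replies s1) = length segs" "count_list (call_segments segs) Oracle_Call = length segs"
    using count_calls_eq_replies[OF s1(1)] s1(2)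
    by (simp_all add: s0_def set_cell_def initial_state_def count_list_replicate)
  \<comment> \<open>Stopping without FAIL takes at least \<open>4 * X + 1 > 0\<close> rounds, and
    each of them makes a call.\<close>
  have nonempty: "segs \<noteq> []"
  proof
    assume "segs = []"
    then have "replies s1 = []" using calls by simp
    then have run: "running K s1" using s1(3) by (auto simp: invariant_def solved_def)
    then have "rounds s1 \<ge> 4 * X + 1" using s1(4) unfinished_iff by (auto simp: running_def)
    then have "0 < rounds s1" using X_nonneg by linarith
    then show False using run \<open>replies s1 = []\<close> K by (auto simp: running_def enough_def)
  qed
  have "\<exists>s' out. steps n orc g answer_code s1 (100 + (n + length segs) * 100) 0 s' \<and> outputs n s' out \<and>
    approximate_solution n J f \<epsilon> out"
  proof (cases "solved s1")
    case True
    have "100 + n * 100 \<le> 100 + (n + length segs) * 100" by simp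
    with answer_solved[OF True] show ?thesis by (meson order.refl steps_mono)
  next
    case False
    then have "running K s1" using s1(3) by (simp add: invariant_def)
    moreover have "100 + length segs * 100 \<le> 100 + (n + length segs) * 100" by simp
    ultimately show ?thesis using answer_running[OF _ s1(4), unfolded calls(1)]
      by (meson order.refl steps_mono)
  qed
  then obtain s2 out post where s2: "exec n orc g answer_code s1 post s2"
    "Oracle_Call \<notin> set post" "count_list post Gradient_Call \<le> 0"
    "count_list post Tick \<le> 100 + (n + length segs) * 100"
    "outputs n s2 out" "approximate_solution n J f \<epsilon> out"
    unfolding steps_def by blast
  let ?pre = "replicate 4 Tick @ replicate (bcost unfinished + 1) Tick"
  let ?t = "?pre @ call_segments segs @ post"
  have cost: "bcost unfinished \<le> 40" by (simp add: unfinished_def)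
  have "exec n orc g solver ?i ?t s2"
    using exec_Seq[OF start exec_Seq[OF s1(1) s2(1)]] by (simp add: solver_def)
  moreover have "real (count_list ?t Oracle_Call) \<le> (4 * X + 2) * real K"
    using s1(3) calls s2(2) by (simp add: invariant_def count_list_replicate count_list_0_iff[THEN iffD2])
  moreover have "work_bounded 1000 n ?t"
  \<comment> \<open>A segment costs at most \<open>410 + 350 * n\<close> and a loop test at most 41,
    together at most \<open>801 * n\<close> as \<open>n \<ge> 1\<close>.\<close>
  proof (rule work_bounded_segments[where B = 801])
    show "real (count_list ?pre Tick) \<le> 1000 * real n"
      using cost n by (simp add: count_list_replicate)
    show "Oracle_Call \<notin> set seg \<and> count_list seg Gradient_Call \<le> 1 \<and> real (count_list seg Tick) \<le> 801 * real n"
      if "seg \<in> set segs" for seg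
    proof -
      have "count_list seg Tick \<le> 801 * n" using s1(2) that cost n by fastforce
      then have "real (count_list seg Tick) \<le> real (801 * n)" by (rule of_nat_mono)
      then show ?thesis using s1(2) that by simp
    qed
    \<comment> \<open>The constant 100 is absorbed because \<open>n + length segs\<close> is at
      least 2.\<close>
    have "count_list post Tick \<le> 199 * (n + length segs)"
      using s2(4) n nonempty by (cases segs) auto
    then have "real (count_list post Tick) \<le> real (199 * (n + length segs))" by (rule of_nat_mono)
    then show "real (count_list post Tick) \<le> (1000 - 801) * (real n + real (length segs))" by simp
  qed (use s2(2,3) nonempty in \<open>auto simp: count_list_replicate\<close>)
  ultimately show ?thesis using s2(5,6) by blast
qed

end

theorem theorem3:
  "\<exists>(prog :: com) (C :: real) (k :: nat).
     \<forall>(n :: nat) (J :: 'j set) (f :: 'j \<Rightarrow> point \<Rightarrow> real) (g :: 'j \<Rightarrow> point \<Rightarrow> point)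
       (h :: 'j \<Rightarrow> point \<Rightarrow> nat \<Rightarrow> nat \<Rightarrow> real) (G :: real) (H :: real).
       n \<ge> 1 \<and> J \<noteq> {} \<and> H > 0 \<and>
       (\<forall>j\<in>J. twice_differentiable_near n (unit_simplex n) (f j) (g j) (h j) \<and>
              convex_fun_on (unit_simplex n) (f j) \<and>
              (\<forall>x\<in>unit_simplex n.
                 psd n (\<lambda>i l. h j x i l - H * (if i = l then 1 else 0)) \<and>
                 L2_set (g j x) {..<n} \<le> G))
       \<longrightarrow> (\<forall>(\<epsilon> :: real) (orc :: nat \<Rightarrow> point \<Rightarrow> 'j option).
              \<epsilon> > 0 \<and> separation_oracle n J f \<epsilon> orc \<longrightarrow>
              (\<exists>t s out. exec n orc g prog (initial_state n G H \<epsilon>) t s \<and>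
                 outputs n s out \<and> approximate_solution n J f \<epsilon> out \<and>
                 real (count_list t Oracle_Call) \<le> soft_bound C k (G\<^sup>2 / H * (1 / \<epsilon>)) \<and>
                 work_bounded C n t))"
\<comment> \<open>One constant serves both the calls and the work. The exponent is 1, since the only
  logarithmic factor is the number of bisection steps per round.\<close>
proof (rule exI[of _ solver], rule exI[of _ 1000], rule exI[of _ 1], intro allI impI, elim conjE)
  fix n :: nat and J :: "'j set" and f :: "'j \<Rightarrow> point \<Rightarrow> real" and g :: "'j \<Rightarrow> point \<Rightarrow> point"
    and h :: "'j \<Rightarrow> point \<Rightarrow> nat \<Rightarrow> nat \<Rightarrow> real" and G H \<epsilon> :: real and orc :: "nat \<Rightarrow> point \<Rightarrow> 'j option"
  assume n: "1 \<le> n" and J: "J \<noteq> {}" and H: "0 < H" and \<epsilon>: "0 < \<epsilon>"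
    and orc: "separation_oracle n J f \<epsilon> orc"
    and smooth: "\<forall>j\<in>J. twice_differentiable_near n (unit_simplex n) (f j) (g j) (h j) \<and>
              convex_fun_on (unit_simplex n) (f j) \<and>
              (\<forall>x\<in>unit_simplex n.
                 psd n (\<lambda>i l. h j x i l - H * (if i = l then 1 else 0)) \<and>
                 L2_set (g j x) {..<n} \<le> G)"
  interpret strongly_convex_program n J f g G H \<epsilon> orc
  proof
    show "f j u \<ge> f j x + (\<Sum>i<n. g j x i * (u i - x i)) + H / 2 * dist2 n u x"
      if "j \<in> J" "x \<in> unit_simplex n" "u \<in> unit_simplex n" for j x u
      by (rule strong_convexity[of n "f j" "g j" "h j"]) (use smooth that in auto)
  qed (use n J H \<epsilon> orc smooth in auto)
  obtain K where K: "1 \<le> K" "16 * X \<le> 2 ^ K" "\<And>b. 1 \<le> b \<Longrightarrow> b < K \<Longrightarrow> 2 ^ b < 16 * X"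
    "real K \<le> 5 * (1 + ln (max 1 X))"
    using doubling_number[of X] by blast
  have X: "G\<^sup>2 / H * (1 / \<epsilon>) = X" by (simp add: X_def)
  have "(4 * X + 2) * real K \<le> (6 * max 1 X) * (5 * (1 + ln (max 1 X)))"
    using K(4) X_nonneg by (intro mult_mono) auto
  also have "\<dots> = 30 * (max 1 X * (1 + ln (max 1 X)))" by simp
  also have "\<dots> \<le> 1000 * (max 1 X * (1 + ln (max 1 X)))"
    by (intro mult_right_mono mult_nonneg_nonneg) auto
  finally have bound: "(4 * X + 2) * real K \<le> soft_bound 1000 1 (G\<^sup>2 / H * (1 / \<epsilon>))"
    unfolding X soft_bound_def by (simp add: mult.assoc)
  have "enough K" using K by (auto simp: enough_def)
  from solver_correct[OF this] bound
  show "\<exists>t s out. exec n orc g solver (initial_state n G H \<epsilon>) t s \<and>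
      outputs n s out \<and> approximate_solution n J f \<epsilon> out \<and>
      real (count_list t Oracle_Call) \<le> soft_bound 1000 1 (G\<^sup>2 / H * (1 / \<epsilon>)) \<and> work_bounded 1000 n t"
    by (meson order.trans)
qed

end
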